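(* For every abstract pseudogroup $A$ there exist a locale $Y$ and an injective pseudogroup homomorphism $A\hookrightarrow\mathcal{H}(Y)$; that is, every pseudogroup admits a faithful representation by partial homeomorphisms on a locale.
   Context: An inverse semigroup is a set $A$ with an associative binary operation $(a,b)\mapsto ab$ such that every $a\in A$ has a unique $a^{-1}\in A$ with $aa^{-1}a=a$ and $a^{-1}aa^{-1}=a^{-1}$. $E(A)\subseteq A$ is the set of idempotents. The natural order on $A$ is: $a\leqslant b$ iff $a=be$ for some $e\in E(A)$. A subset $S\subseteq A$ is jointly compatible if for all $a,b\in S$ both $ab^{-1}$ and $a^{-1}b$ are idempotent. $A$ is an abstract pseudogroup if every jointly compatible subset $S\subseteq A$ (including $\emptyset$) has a join $\bigvee S$ in the natural order, and $a(\bigvee S)=\bigvee_{s\in S} as$, $(\bigvee S)a=\bigvee_{s\in S} sa$ for all $a\in A$. A pseudogroup has a zero $0=\bigvee\emptyset$, a unit $1=\bigvee E(A)$, and all binary meets in the natural order. A pseudogroup homomorphism is a function between pseudogroups preserving multiplication, the unit, all joins (of jointly compatible subsets) and all binary meets in the natural order. A frame is a complete lattice in which $a\wedge\bigvee_I b_i=\bigvee_I (a\wedge b_i)$; frame homomorphisms preserve all joins and all finite meets. The category of locales is the opposite of the category of frames; a locale and its frame are denoted by the same symbol, the frame homomorphism corresponding to a locale morphism $f$ is denoted $f^\ast$, and an isomorphism of locales is called a homeomorphism. Each element $u$ of a locale $Y$ induces an open sublocale $\langle u\rangle\subseteq Y$, whose frame is $\{v\in Y: v\leqslant u\}$, with inclusion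 given by the surjective frame homomorphism $v\mapsto v\wedge u$. For a locale $Y$, $\mathcal{H}(Y)$ is the pseudogroup of partial homeomorphisms of $Y$: its elements are homeomorphisms $\langle u\rangle\xrightarrow{\sim}\langle v\rangle$ between open sublocales of $Y$, multiplication is composition $fg=f\circ g$ of partial maps (with domain the inverse image under $g$ of the domain of $f$), and its natural order is restriction to a smaller open sublocale. *)

theory Defs
  imports "HOL-Algebra.Complete_Lattice"
begin

section \<open>Abstract pseudogroups\<close>

record 'a semigroup_obj = "'a partial_object" +
  mul :: "'a \<Rightarrow> 'a \<Rightarrow> 'a"  (infixl \<open>\<odot>\<index>\<close> 70)

definition is_inverse :: "('a, 'm) semigroup_obj_scheme \<Rightarrow> 'a \<Rightarrow> 'a \<Rightarrow> bool" where
  "is_inverse A a b \<longleftrightarrow> a \<odot>\<^bsub>A\<^esub> b \<odot>\<^bsub>A\<^esub> a = a \<and> b \<odot>\<^bsub>A\<^esub> a \<odot>\<^bsub>A\<^esub> b = b"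

locale inverse_semigroup =
  fixes A (structure)
  assumes mul_closed: "\<lbrakk>a \<in> carrier A; b \<in> carrier A\<rbrakk> \<Longrightarrow> a \<odot> b \<in> carrier A"
    and mul_assoc: "\<lbrakk>a \<in> carrier A; b \<in> carrier A; c \<in> carrier A\<rbrakk>
      \<Longrightarrow> (a \<odot> b) \<odot> c = a \<odot> (b \<odot> c)"
    and ex1_inverse: "a \<in> carrier A \<Longrightarrow> \<exists>!b. b \<in> carrier A \<and> is_inverse A a b"

definition sinv :: "('a, 'm) semigroup_obj_scheme \<Rightarrow> 'a \<Rightarrow> 'a" where
  "sinv A a = (THE b. b \<in> carrier A \<and> is_inverse A a b)"

definition idempotents :: "('a, 'm) semigroup_obj_scheme \<Rightarrow> 'a set" where
  "idempotents A = {e \<in> carrier A. e \<odot>\<^bsub>A\<^esub> e = e}"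

text \<open>The natural order as a \<^typ>\<open>'a gorder\<close>, so that joins and meets are those of
  HOL-Algebra.\<close>

definition natural_order :: "('a, 'm) semigroup_obj_scheme \<Rightarrow> 'a gorder" where
  "natural_order A =
    \<lparr>carrier = carrier A, eq = (=), le = (\<lambda>a b. \<exists>e\<in>idempotents A. a = b \<odot>\<^bsub>A\<^esub> e)\<rparr>"

definition jointly_compatible :: "('a, 'm) semigroup_obj_scheme \<Rightarrow> 'a set \<Rightarrow> bool" where
  "jointly_compatible A S \<longleftrightarrow> S \<subseteq> carrier A \<and>
    (\<forall>a\<in>S. \<forall>b\<in>S. a \<odot>\<^bsub>A\<^esub> sinv A b \<in> idempotents A \<and> sinv A a \<odot>\<^bsub>A\<^esub> b \<in> idempotents A)"

locale pseudogroup = inverse_semigroup +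
  assumes join_exists: "jointly_compatible A S
      \<Longrightarrow> \<exists>s. least (natural_order A) s (Upper (natural_order A) S)"
    and mul_join_left: "\<lbrakk>a \<in> carrier A; jointly_compatible A S\<rbrakk>
      \<Longrightarrow> a \<odot> \<Squnion>\<^bsub>natural_order A\<^esub> S = \<Squnion>\<^bsub>natural_order A\<^esub> ((\<lambda>s. a \<odot> s) ` S)"
    and mul_join_right: "\<lbrakk>a \<in> carrier A; jointly_compatible A S\<rbrakk>
      \<Longrightarrow> \<Squnion>\<^bsub>natural_order A\<^esub> S \<odot> a = \<Squnion>\<^bsub>natural_order A\<^esub> ((\<lambda>s. s \<odot> a) ` S)"

definition pg_unit :: "('a, 'm) semigroup_obj_scheme \<Rightarrow> 'a" where
  "pg_unit A = \<Squnion>\<^bsub>natural_order A\<^esub> (idempotents A)"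

locale pseudogroup_hom = A: pseudogroup A + B: pseudogroup B
  for A (structure) and B (structure) +
  fixes h
  assumes hom_closed: "h \<in> carrier A \<rightarrow> carrier B"
    and hom_mul: "\<lbrakk>a \<in> carrier A; b \<in> carrier A\<rbrakk>
      \<Longrightarrow> h (a \<odot>\<^bsub>A\<^esub> b) = h a \<odot>\<^bsub>B\<^esub> h b"
    and hom_unit: "h (pg_unit A) = pg_unit B"
    and hom_join: "jointly_compatible A S
      \<Longrightarrow> h (\<Squnion>\<^bsub>natural_order A\<^esub> S) = \<Squnion>\<^bsub>natural_order B\<^esub> (h ` S)"
    and hom_meet: "\<lbrakk>a \<in> carrier A; b \<in> carrier A\<rbrakk>
      \<Longrightarrow> h (a \<sqinter>\<^bsub>natural_order A\<^esub> b) = h a \<sqinter>\<^bsub>natural_order B\<^esub> h b"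

section \<open>Frames and locales\<close>

text \<open>A locale (in the sense of point-free topology) is represented by its frame; morphisms of
  locales are represented by the frame homomorphisms in the opposite direction.\<close>

locale frame = complete_lattice +
  assumes meet_Sup_distrib: "\<lbrakk>a \<in> carrier L; B \<subseteq> carrier L\<rbrakk>
    \<Longrightarrow> a \<sqinter> \<Squnion> B = \<Squnion> ((\<lambda>b. a \<sqinter> b) ` B)"

text \<open>The empty finite meet is included, so the top element is preserved.\<close>

locale frame_hom = F: frame F + G: frame G
  for F (structure) and G (structure) +
  fixes \<phi>
  assumes frame_hom_closed: "\<phi> \<in> carrier F \<rightarrow> carrier G"
    and frame_hom_Sup: "S \<subseteq> carrier F \<Longrightarrow> \<phi> (\<Squnion>\<^bsub>F\<^esub> S) = \<Squnion>\<^bsub>G\<^esub> (\<phi> ` S)"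
    and frame_hom_finite_Inf: "\<lbrakk>finite S; S \<subseteq> carrier F\<rbrakk>
      \<Longrightarrow> \<phi> (\<Sqinter>\<^bsub>F\<^esub> S) = \<Sqinter>\<^bsub>G\<^esub> (\<phi> ` S)"

definition frame_iso ::
  "('a, 'm) gorder_scheme \<Rightarrow> ('b, 'n) gorder_scheme \<Rightarrow> ('a \<Rightarrow> 'b) \<Rightarrow> bool" where
  "frame_iso F G \<phi> \<longleftrightarrow> frame_hom F G \<phi> \<and>
    (\<exists>\<psi>. frame_hom G F \<psi> \<and> (\<forall>x\<in>carrier F. \<psi> (\<phi> x) = x) \<and> (\<forall>y\<in>carrier G. \<phi> (\<psi> y) = y))"

definition open_sublocale :: "('a, 'm) gorder_scheme \<Rightarrow> 'a \<Rightarrow> ('a, 'm) gorder_scheme" where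
  "open_sublocale Y u = Y\<lparr>carrier := {v \<in> carrier Y. v \<sqsubseteq>\<^bsub>Y\<^esub> u}\<rparr>"

section \<open>The pseudogroup of partial homeomorphisms of a locale\<close>

text \<open>A homeomorphism from the open sublocale of \<open>u\<close> to that of \<open>v\<close> is given by \<open>source = u\<close>,
  \<open>target = v\<close> and its inverse image map \<open>pullback\<close>, which goes from the frame of the
  target to the frame of the source. The pullback is extensional, so that equality of records is
  equality of partial homeomorphisms.\<close>

record 'a phomeo =
  source :: 'a
  target :: 'a
  pullback :: "'a \<Rightarrow> 'a"

definition phomeos :: "('a, 'm) gorder_scheme \<Rightarrow> 'a phomeo set" where
  "phomeos Y = {f. source f \<in> carrier Y \<and> target f \<in> carrier Y \<and>
     pullback f \<in> extensional (carrier (open_sublocale Y (target f))) \<and>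
     frame_iso (open_sublocale Y (target f)) (open_sublocale Y (source f)) (pullback f)}"

text \<open>In the composite \<open>f \<circ> g\<close>, the maps meet in the open \<open>m = source f \<sqinter> target g\<close>.
  The domain is the inverse image of \<open>m\<close> under \<open>g\<close>, and the target is the image of \<open>m\<close> under
  \<open>f\<close>, that is, the unique open of the target of \<open>f\<close> whose inverse image is \<open>m\<close>.\<close>

definition phomeo_comp ::
  "('a, 'm) gorder_scheme \<Rightarrow> 'a phomeo \<Rightarrow> 'a phomeo \<Rightarrow> 'a phomeo" where
  "phomeo_comp Y f g =
    (let m = source f \<sqinter>\<^bsub>Y\<^esub> target g;
         w = inv_into (carrier (open_sublocale Y (target f))) (pullback f) m
     in \<lparr>source = pullback g m, target = w,
         pullback = compose (carrier (open_sublocale Y w)) (pullback g) (pullback f)\<rparr>)"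

definition partial_homeos :: "('a, 'm) gorder_scheme \<Rightarrow> 'a phomeo semigroup_obj" where
  "partial_homeos Y = \<lparr>carrier = phomeos Y, mul = phomeo_comp Y\<rparr>"

end

(*  The left regular representation. The locale Y consists of the order ideals of A that are closed
    under compatible joins. An element a acts as the partial homeomorphism U |-> a U, defined on the
    ideal of all x with a^-1 a x = x. The action on the principal ideal of x determines a x, which
    gives faithfulness, and also preservation of binary meets: wherever a and b act equally on the
    opens below U, one has a x = b x for all x in U, so that U is in the domain of the meet of a and b. *)

theory Submission
  imports Defs
begin

text \<open>Conjugation on the frame of idempotents would be the obvious action, but it is not
  faithful: in a nontrivial group with a zero adjoined, both idempotents are fixed by conjugation
  with every group element. Hence the opens are built from all elements of \<open>A\<close>. Since
  \<open>y \<preceq> x\<close> means that \<open>y\<close> is \<open>x\<close> times an idempotent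
  on the right, left multiplication is compatible with passing to smaller elements. Closure under
  compatible joins is imposed so that the domain of a join is covered by the domains of its members,
  which is what preservation of joins amounts to; distributivity of multiplication over joins makes
  these ideals a frame. The other half of the work is that the partial homeomorphisms of any locale
  form a pseudogroup. They are replaced by their graphs, order isomorphisms between principal ideals
  written as relations. Composition, inverse and natural order become relational composition,
  converse and inclusion, and joins are obtained by gluing, which rests on the infinite distributive
  law.\<close>

section \<open>Inverse semigroups and pseudogroups\<close>

context partial_order
begin

text \<open>HOL-Algebra picks a least upper bound by Hilbert choice; antisymmetry makes the choice
  unique. This form also serves orders such as \<open>natural_order A\<close>, where only some joins
  exist.\<close>

lemma sup_eqI:
  assumes "b \<in> carrier L" "S \<subseteq> carrier L" "\<And>s. s \<in> S \<Longrightarrow> s \<sqsubseteq> b"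
    and "\<And>c. c \<in> carrier L \<Longrightarrow> (\<And>s. s \<in> S \<Longrightarrow> s \<sqsubseteq> c) \<Longrightarrow> b \<sqsubseteq> c"
  shows "\<Squnion>S = b"
proof -
  have "least L b (Upper L S)"
    using assms(1,2,3) by (intro least_UpperI) (auto simp: Upper_def intro!: assms(4))
  then show ?thesis
    unfolding sup_def using least_unique by (intro some_equality) auto
qed

lemma inf_eqI:
  assumes "b \<in> carrier L" "S \<subseteq> carrier L" "\<And>s. s \<in> S \<Longrightarrow> b \<sqsubseteq> s"
    and "\<And>c. c \<in> carrier L \<Longrightarrow> (\<And>s. s \<in> S \<Longrightarrow> c \<sqsubseteq> s) \<Longrightarrow> c \<sqsubseteq> b"
  shows "\<Sqinter>S = b"
proof -
  have "greatest L b (Lower L S)"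
    using assms(1,2,3) by (intro greatest_LowerI) (auto simp: Lower_def intro!: assms(4))
  then show ?thesis
    unfolding inf_def using greatest_unique by (intro some_equality) auto
qed

lemma meet_eqI:
  assumes "m \<in> carrier L" "a \<in> carrier L" "b \<in> carrier L" "m \<sqsubseteq> a" "m \<sqsubseteq> b"
    and "\<And>c. c \<in> carrier L \<Longrightarrow> c \<sqsubseteq> a \<Longrightarrow> c \<sqsubseteq> b \<Longrightarrow> c \<sqsubseteq> m"
  shows "a \<sqinter> b = m"
  unfolding meet_def using assms by (intro inf_eqI) auto

end

section \<open>Inverse semigroups: inverses and commuting idempotents\<close>

context inverse_semigroup
begin

abbreviation inverse_of (\<open>\<iota>\<close>) where "\<iota> \<equiv> sinv A"

abbreviation nat_le (infix \<open>\<preceq>\<close> 50) where "a \<preceq> b \<equiv> le (natural_order A) a b"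

declare mul_closed [simp, intro]

lemma sinv_props:
  assumes "a \<in> carrier A"
  shows sinv_closed [simp, intro]: "\<iota> a \<in> carrier A"
    and mul_sinv_mul: "a \<odot> \<iota> a \<odot> a = a"
    and sinv_mul_sinv: "\<iota> a \<odot> a \<odot> \<iota> a = \<iota> a"
  using theI'[OF ex1_inverse[OF assms]] unfolding sinv_def is_inverse_def by auto

lemma sinv_unique:
  assumes "a \<in> carrier A" "b \<in> carrier A" "a \<odot> b \<odot> a = a" "b \<odot> a \<odot> b = b"
  shows "\<iota> a = b"
  using ex1_inverse[OF assms(1)] assms sinv_props[OF assms(1)] unfolding is_inverse_def by metis

lemma sinv_sinv [simp]: "a \<in> carrier A \<Longrightarrow> \<iota> (\<iota> a) = a"
  by (intro sinv_unique) (auto simp: mul_sinv_mul sinv_mul_sinv)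

text \<open>Cancellation in right-nested form, so that it still applies after
  \<open>mul_assoc\<close> has moved all brackets to the right.\<close>

lemma sinv_cancel:
  assumes "a \<in> carrier A"
  shows "x \<in> carrier A \<Longrightarrow> a \<odot> (\<iota> a \<odot> (a \<odot> x)) = a \<odot> x"
    and "x \<in> carrier A \<Longrightarrow> \<iota> a \<odot> (a \<odot> (\<iota> a \<odot> x)) = \<iota> a \<odot> x"
    and "a \<odot> (\<iota> a \<odot> a) = a" "\<iota> a \<odot> (a \<odot> \<iota> a) = \<iota> a"
  using assms mul_sinv_mul[of a] sinv_mul_sinv[of a]
  by (metis mul_assoc mul_closed sinv_closed)+

lemma idempotentsD [dest]:
  "e \<in> idempotents A \<Longrightarrow> e \<in> carrier A" "e \<in> idempotents A \<Longrightarrow> e \<odot> e = e"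
  by (auto simp: idempotents_def)

lemma idempotentsI [intro?]: "e \<in> carrier A \<Longrightarrow> e \<odot> e = e \<Longrightarrow> e \<in> idempotents A"
  by (auto simp: idempotents_def)

lemma idempotents_sinv [simp]: "e \<in> idempotents A \<Longrightarrow> \<iota> e = e"
  by (rule sinv_unique) auto

lemma idempotent_left_cancel:
  "e \<in> idempotents A \<Longrightarrow> x \<in> carrier A \<Longrightarrow> e \<odot> (e \<odot> x) = e \<odot> x"
  by (metis idempotentsD mul_assoc)

text \<open>The inverse \<open>x\<close> of \<open>e f\<close> equals \<open>f x e\<close>, so \<open>x\<close> is idempotent, hence its own inverse.\<close>

lemma idempotents_mul_closed:
  assumes "e \<in> idempotents A" "f \<in> idempotents A"
  shows "e \<odot> f \<in> idempotents A"
proof -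
  have [simp]: "e \<in> carrier A" "f \<in> carrier A" using assms by auto
  define x where "x = \<iota> (e \<odot> f)"
  have [simp]: "x \<in> carrier A" by (simp add: x_def)
  have x1: "x \<odot> (e \<odot> (f \<odot> x)) = x" and x2: "e \<odot> (f \<odot> (x \<odot> (e \<odot> f))) = e \<odot> f"
    using sinv_mul_sinv[of "e \<odot> f"] mul_sinv_mul[of "e \<odot> f"] by (simp_all add: x_def mul_assoc)
  have x3: "x \<odot> (e \<odot> (f \<odot> (x \<odot> y))) = x \<odot> y" if "y \<in> carrier A" for y
    using x1 that by (metis \<open>e \<in> carrier A\<close> \<open>f \<in> carrier A\<close> \<open>x \<in> carrier A\<close> mul_assoc mul_closed)
  note [simp] = idempotent_left_cancel[OF assms(1)] idempotent_left_cancel[OF assms(2)]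
  have "x = f \<odot> (x \<odot> e)"
    unfolding x_def
    by (rule sinv_unique) (auto simp: mul_assoc x_def[symmetric] x2 x3)
  then have "x \<odot> x = f \<odot> (x \<odot> e) \<odot> (f \<odot> (x \<odot> e))" by simp
  also have "\<dots> = f \<odot> (x \<odot> e)" by (simp add: mul_assoc x3)
  finally have "x \<in> idempotents A" using \<open>x = f \<odot> (x \<odot> e)\<close> by (intro idempotentsI) auto
  then show ?thesis using idempotents_sinv[of x] sinv_sinv[of "e \<odot> f"] by (simp add: x_def)
qed

text \<open>The products \<open>e \<odot> f\<close> and \<open>f \<odot> e\<close> are mutually
  inverse, while an idempotent is its own inverse; uniqueness of inverses identifies them.\<close>

lemma idempotents_commute:
  assumes "e \<in> idempotents A" "f \<in> idempotents A"
  shows "e \<odot> f = f \<odot> e"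
proof -
  have [simp]: "e \<in> carrier A" "f \<in> carrier A" using assms by auto
  note [simp] = idempotent_left_cancel[OF assms(1)] idempotent_left_cancel[OF assms(2)]
  have "(e \<odot> f) \<odot> (e \<odot> f) = e \<odot> f" "(f \<odot> e) \<odot> (f \<odot> e) = f \<odot> e"
    using idempotents_mul_closed assms by blast+
  then have "\<iota> (e \<odot> f) = f \<odot> e"
    by (intro sinv_unique) (auto simp: mul_assoc)
  then show ?thesis using idempotents_sinv idempotents_mul_closed assms by metis
qed

lemma sinv_mul_idem [simp, intro]:
  assumes "a \<in> carrier A"
  shows "\<iota> a \<odot> a \<in> idempotents A" "a \<odot> \<iota> a \<in> idempotents A"
  using assms by (auto intro!: idempotentsI simp: mul_assoc sinv_cancel)

text \<open>Everything rests on equation \<open>1\<close>: the idempotents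
  \<open>\<iota> a \<odot> a\<close> and \<open>b \<odot> \<iota> b\<close> meet in the middle of
  each triple product, and commuting them lets both sides cancel.\<close>

lemma sinv_mul:
  assumes [simp]: "a \<in> carrier A" "b \<in> carrier A"
  shows "\<iota> (a \<odot> b) = \<iota> b \<odot> \<iota> a"
proof (rule sinv_unique)
  have 1: "\<iota> a \<odot> a \<odot> (b \<odot> \<iota> b) = b \<odot> \<iota> b \<odot> (\<iota> a \<odot> a)" by (rule idempotents_commute) auto
  have "a \<odot> b \<odot> (\<iota> b \<odot> \<iota> a) \<odot> (a \<odot> b) = a \<odot> (b \<odot> \<iota> b \<odot> (\<iota> a \<odot> a)) \<odot> b"
    by (simp add: mul_assoc)
  also have "\<dots> = a \<odot> b" unfolding 1[symmetric] by (simp add: mul_assoc sinv_cancel)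
  finally show "a \<odot> b \<odot> (\<iota> b \<odot> \<iota> a) \<odot> (a \<odot> b) = a \<odot> b" .
  have "\<iota> b \<odot> \<iota> a \<odot> (a \<odot> b) \<odot> (\<iota> b \<odot> \<iota> a) = \<iota> b \<odot> (\<iota> a \<odot> a \<odot> (b \<odot> \<iota> b)) \<odot> \<iota> a"
    by (simp add: mul_assoc)
  also have "\<dots> = \<iota> b \<odot> \<iota> a" unfolding 1 by (simp add: mul_assoc sinv_cancel)
  finally show "\<iota> b \<odot> \<iota> a \<odot> (a \<odot> b) \<odot> (\<iota> b \<odot> \<iota> a) = \<iota> b \<odot> \<iota> a" .
qed auto

text \<open>Conjugates carry an idempotent across \<open>a\<close>; they are the witnesses that make
  the right and left descriptions of the natural order agree.\<close>

lemma idempotents_conj: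
  assumes "a \<in> carrier A" "e \<in> idempotents A"
  shows "a \<odot> e \<odot> \<iota> a \<in> idempotents A"
proof
  have [simp]: "e \<in> carrier A" using assms by auto
  have "a \<odot> e \<odot> \<iota> a \<odot> (a \<odot> e \<odot> \<iota> a) = a \<odot> ((e \<odot> (\<iota> a \<odot> a)) \<odot> e) \<odot> \<iota> a"
    using assms by (simp add: mul_assoc)
  also have "\<dots> = a \<odot> ((\<iota> a \<odot> a) \<odot> e \<odot> e) \<odot> \<iota> a"
    using assms idempotents_commute[of e "\<iota> a \<odot> a"] by simp
  also have "\<dots> = a \<odot> e \<odot> \<iota> a"
    using assms by (simp add: mul_assoc sinv_cancel idempotent_left_cancel)
  finally show "a \<odot> e \<odot> \<iota> a \<odot> (a \<odot> e \<odot> \<iota> a) = a \<odot> e \<odot> \<iota> a" .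
qed (use assms in auto)

section \<open>The natural partial order\<close>

lemma carrier_natural_order [simp]: "carrier (natural_order A) = carrier A"
  by (simp add: natural_order_def)

lemma nat_le_iff: "a \<preceq> b \<longleftrightarrow> (\<exists>e\<in>idempotents A. a = b \<odot> e)"
  by (simp add: natural_order_def)

text \<open>The factor moves across by
  \<open>b \<odot> e = (b \<odot> e \<odot> \<iota> b) \<odot> b\<close>, and back by the mirrored
  identity. This gives right multiplication and inversion the same monotonicity as left
  multiplication.\<close>

lemma nat_le_iff_left:
  assumes [simp]: "b \<in> carrier A"
  shows "a \<preceq> b \<longleftrightarrow> (\<exists>e\<in>idempotents A. a = e \<odot> b)"
proof
  assume "a \<preceq> b"
  then obtain e where e: "e \<in> idempotents A" and a: "a = b \<odot> e" by (auto simp: nat_le_iff)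
  have [simp]: "e \<in> carrier A" using e by auto
  have "b \<odot> e \<odot> \<iota> b \<odot> b = b \<odot> (e \<odot> (\<iota> b \<odot> b))" by (simp add: mul_assoc)
  also have "\<dots> = a"
    using e a idempotents_commute[of e "\<iota> b \<odot> b"] by (simp add: mul_assoc sinv_cancel)
  finally show "\<exists>e\<in>idempotents A. a = e \<odot> b" using idempotents_conj[OF assms e] by auto
next
  assume "\<exists>e\<in>idempotents A. a = e \<odot> b"
  then obtain e where e: "e \<in> idempotents A" and a: "a = e \<odot> b" by auto
  have [simp]: "e \<in> carrier A" using e by auto
  have "b \<odot> (\<iota> b \<odot> e \<odot> b) = (b \<odot> \<iota> b) \<odot> e \<odot> b" by (simp add: mul_assoc)
  also have "\<dots> = e \<odot> (b \<odot> \<iota> b) \<odot> b"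
    using e idempotents_commute[of e "b \<odot> \<iota> b"] by simp
  also have "\<dots> = a" using a by (simp add: mul_assoc sinv_cancel)
  finally show "a \<preceq> b"
    using idempotents_conj[of "\<iota> b" e] e unfolding nat_le_iff by (metis assms sinv_closed sinv_sinv)
qed

text \<open>A smaller element is \<open>b\<close> cut down to its own domain idempotent. The second
  equation allows \<open>\<iota> b\<close> to be traded for \<open>\<iota> a\<close> in front of
  \<open>a\<close>, which is how domains of joins and meets are compared later.\<close>

lemma nat_le_eq:
  assumes [simp]: "a \<in> carrier A" "b \<in> carrier A" and ab: "a \<preceq> b"
  shows "a = b \<odot> (\<iota> a \<odot> a)" "\<iota> b \<odot> a = \<iota> a \<odot> a"
proof -
  from ab obtain e where e: "e \<in> idempotents A" and a: "a = b \<odot> e" by (auto simp: nat_le_iff)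
  have [simp]: "e \<in> carrier A" using e by auto
  have "\<iota> a \<odot> a = (e \<odot> (\<iota> b \<odot> b)) \<odot> e"
    using e by (simp add: a sinv_mul mul_assoc)
  also have "\<dots> = \<iota> b \<odot> b \<odot> e"
    using e idempotents_commute[of e "\<iota> b \<odot> b"] by (simp add: mul_assoc idempotentsD)
  finally show "a = b \<odot> (\<iota> a \<odot> a)" "\<iota> b \<odot> a = \<iota> a \<odot> a"
    using a by (simp_all add: mul_assoc sinv_cancel)
qed

lemma nat_le_refl [simp, intro]: "a \<in> carrier A \<Longrightarrow> a \<preceq> a"
  unfolding nat_le_iff using sinv_mul_idem(1) sinv_cancel(3) by metis

lemma nat_le_mul_idem [simp, intro]:
  assumes "a \<in> carrier A" "e \<in> idempotents A"
  shows "a \<odot> e \<preceq> a" "e \<odot> a \<preceq> a"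
  using assms nat_le_iff nat_le_iff_left by blast+

lemma nat_le_trans:
  assumes "a \<preceq> b" "b \<preceq> c" "c \<in> carrier A"
  shows "a \<preceq> c"
  using assms unfolding nat_le_iff
  by (metis idempotentsD(1) idempotents_mul_closed mul_assoc)

lemma nat_le_antisym:
  assumes "a \<preceq> b" "b \<preceq> a" "a \<in> carrier A" "b \<in> carrier A"
  shows "a = b"
proof -
  obtain e f where e: "e \<in> idempotents A" "a = b \<odot> e" and f: "f \<in> idempotents A" "b = a \<odot> f"
    using assms(1,2) by (auto simp: nat_le_iff)
  have "a = a \<odot> f \<odot> e" using e f by simp
  also have "\<dots> = a \<odot> f"
    using idempotents_commute[OF e(1) f(1)] e f assms by (metis idempotentsD mul_assoc)
  finally show ?thesis using f by simp
qed

sublocale natural: partial_order "natural_order A"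
  by unfold_locales
    \<comment> \<open>Only the \<open>eq\<close> component is unfolded; the order itself stays
      folded so that the lemmas about \<open>\<preceq>\<close> apply.\<close>
    (auto simp: natural_order_def[of A, THEN arg_cong[where f = eq]]
      intro: nat_le_antisym nat_le_trans)

lemma nat_le_mul_left:
  assumes "a \<preceq> b" "b \<in> carrier A" "c \<in> carrier A"
  shows "c \<odot> a \<preceq> c \<odot> b"
  using assms unfolding nat_le_iff by (metis idempotentsD(1) mul_assoc)

lemma nat_le_mul_right:
  assumes "a \<preceq> b" "b \<in> carrier A" "c \<in> carrier A"
  shows "a \<odot> c \<preceq> b \<odot> c"
  using assms by (metis nat_le_iff_left idempotentsD(1) mul_assoc mul_closed)

lemma nat_le_sinv:
  assumes "a \<preceq> b" "b \<in> carrier A"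
  shows "\<iota> a \<preceq> \<iota> b"
  using assms by (metis nat_le_iff nat_le_iff_left idempotentsD(1) sinv_mul idempotents_sinv sinv_closed)

lemma nat_le_idempotent:
  assumes "a \<preceq> e" "e \<in> idempotents A"
  shows "a \<in> idempotents A"
  using assms unfolding nat_le_iff using idempotents_mul_closed by auto

text \<open>The products are bounded by \<open>b \<odot> \<iota> b\<close> and
  \<open>\<iota> b \<odot> b\<close>, and whatever lies below an idempotent is idempotent. This
  turns compatibility checks into the exhibition of one upper bound.\<close>

lemma jointly_compatible_bounded:
  assumes "S \<subseteq> carrier A" "b \<in> carrier A" "\<And>s. s \<in> S \<Longrightarrow> s \<preceq> b"
  shows "jointly_compatible A S"
  unfolding jointly_compatible_def
proof (intro conjI ballI assms(1))
  fix s t assume st: "s \<in> S" "t \<in> S"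
  then have [simp]: "s \<in> carrier A" "t \<in> carrier A" using assms(1) by auto
  note [simp] = assms(2)
  have "s \<odot> \<iota> t \<preceq> b \<odot> \<iota> b"
    using nat_le_mul_right[of s b "\<iota> t"] nat_le_mul_left[of "\<iota> t" "\<iota> b" b] assms(3) st nat_le_sinv[of t b]
    by (auto intro: nat_le_trans)
  then show "s \<odot> \<iota> t \<in> idempotents A" by (auto intro: nat_le_idempotent)
  have "\<iota> s \<odot> t \<preceq> \<iota> b \<odot> b"
    using nat_le_mul_left[of t b "\<iota> s"] nat_le_mul_right[of "\<iota> s" "\<iota> b" b] assms(3) st nat_le_sinv[of s b]
    by (auto intro: nat_le_trans)
  then show "\<iota> s \<odot> t \<in> idempotents A" by (auto intro: nat_le_idempotent)
qed

lemma idempotents_jointly_compatible: "jointly_compatible A (idempotents A)"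
  unfolding jointly_compatible_def by (auto intro: idempotents_mul_closed)

lemmas join_eqI = natural.sup_eqI[unfolded carrier_natural_order]

lemmas meet_eqI = natural.meet_eqI[unfolded carrier_natural_order]

end

section \<open>Joins, unit and binary meets in a pseudogroup\<close>

context pseudogroup
begin

abbreviation pg_join (\<open>\<Or>\<close>) where "\<Or> \<equiv> Lattice.sup (natural_order A)"

lemma join_props:
  assumes "jointly_compatible A S"
  shows join_closed [simp, intro]: "\<Or>S \<in> carrier A"
    and join_upper: "s \<in> S \<Longrightarrow> s \<preceq> \<Or>S"
    and join_least: "c \<in> carrier A \<Longrightarrow> (\<And>s. s \<in> S \<Longrightarrow> s \<preceq> c) \<Longrightarrow> \<Or>S \<preceq> c"
proof -
  have S: "S \<subseteq> carrier A" using assms by (simp add: jointly_compatible_def)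
  have *: "least (natural_order A) (\<Or>S) (Upper (natural_order A) S)"
    using join_exists[OF assms] unfolding sup_def by (rule someI_ex)
  show "\<Or>S \<in> carrier A" using least_closed[OF *] by simp
  show "s \<in> S \<Longrightarrow> s \<preceq> \<Or>S" using least_Upper_above[OF *, of s] S by simp
  show "c \<in> carrier A \<Longrightarrow> (\<And>s. s \<in> S \<Longrightarrow> s \<preceq> c) \<Longrightarrow> \<Or>S \<preceq> c"
    using least_le[OF *, of c] by (auto simp: Upper_def)
qed

lemma jointly_compatible_mul_left:
  assumes "jointly_compatible A S" "a \<in> carrier A"
  shows "jointly_compatible A ((\<lambda>s. a \<odot> s) ` S)"
  using assms
  by (intro jointly_compatible_bounded[where b = "a \<odot> \<Or>S"])
    (auto simp: jointly_compatible_def intro!: nat_le_mul_left join_upper)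

lemma jointly_compatible_mul_right:
  assumes "jointly_compatible A S" "a \<in> carrier A"
  shows "jointly_compatible A ((\<lambda>s. s \<odot> a) ` S)"
  using assms
  by (intro jointly_compatible_bounded[where b = "\<Or>S \<odot> a"])
    (auto simp: jointly_compatible_def intro!: nat_le_mul_right join_upper)

lemma pg_unit_closed [simp, intro]: "pg_unit A \<in> carrier A"
  unfolding pg_unit_def using idempotents_jointly_compatible by auto

text \<open>After distributing, all terms \<open>e \<odot> a\<close> lie below \<open>a\<close>, and
  the idempotent \<open>e = a \<odot> \<iota> a\<close> attains \<open>a\<close> itself.\<close>

lemma pg_unit_left [simp]:
  assumes "a \<in> carrier A"
  shows "pg_unit A \<odot> a = a"
proof -
  have "pg_unit A \<odot> a = \<Or>((\<lambda>s. s \<odot> a) ` idempotents A)"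
    unfolding pg_unit_def using assms idempotents_jointly_compatible by (rule mul_join_right)
  also have "\<dots> = a"
  proof (rule join_eqI)
    fix c assume "\<And>s. s \<in> (\<lambda>s. s \<odot> a) ` idempotents A \<Longrightarrow> s \<preceq> c"
    from this[OF imageI, of "a \<odot> \<iota> a"] show "a \<preceq> c" using assms by (simp add: mul_sinv_mul)
  qed (use assms in auto)
  finally show ?thesis .
qed

lemma pg_unit_right [simp]:
  assumes "a \<in> carrier A"
  shows "a \<odot> pg_unit A = a"
proof -
  have "a \<odot> pg_unit A = \<Or>((\<lambda>s. a \<odot> s) ` idempotents A)"
    unfolding pg_unit_def using assms idempotents_jointly_compatible by (rule mul_join_left)
  also have "\<dots> = a"
  proof (rule join_eqI)
    fix c assume "\<And>s. s \<in> (\<lambda>s. a \<odot> s) ` idempotents A \<Longrightarrow> s \<preceq> c"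
    from this[OF imageI, of "\<iota> a \<odot> a"] show "a \<preceq> c" using assms by (simp add: sinv_cancel)
  qed (use assms in auto)
  finally show ?thesis .
qed

text \<open>The common lower bounds of \<open>a\<close> and \<open>b\<close> are bounded by
  \<open>a\<close>, hence compatible, and their join is the meet.\<close>

lemma meet_props:
  assumes "a \<in> carrier A" "b \<in> carrier A"
  shows pg_meet_closed: "a \<sqinter>\<^bsub>natural_order A\<^esub> b \<in> carrier A"
    and pg_meet_left: "a \<sqinter>\<^bsub>natural_order A\<^esub> b \<preceq> a"
    and pg_meet_right: "a \<sqinter>\<^bsub>natural_order A\<^esub> b \<preceq> b"
    and pg_meet_greatest: "\<lbrakk>c \<in> carrier A; c \<preceq> a; c \<preceq> b\<rbrakk> \<Longrightarrow> c \<preceq> a \<sqinter>\<^bsub>natural_order A\<^esub> b"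
proof -
  define S where "S = {c \<in> carrier A. c \<preceq> a \<and> c \<preceq> b}"
  have "jointly_compatible A S"
    using assms by (intro jointly_compatible_bounded[where b = a]) (auto simp: S_def)
  note S = join_props[OF this]
  have *: "\<Or>S \<preceq> a" "\<Or>S \<preceq> b" by (rule S(3); use assms in \<open>simp add: S_def\<close>)+
  have **: "c \<preceq> \<Or>S" if "c \<in> carrier A" "c \<preceq> a" "c \<preceq> b" for c
    by (rule S(2)) (use that in \<open>simp add: S_def\<close>)
  have "a \<sqinter>\<^bsub>natural_order A\<^esub> b = \<Or>S"
    using assms S(1) * by (intro meet_eqI) (auto intro: **)
  then show "a \<sqinter>\<^bsub>natural_order A\<^esub> b \<in> carrier A" "a \<sqinter>\<^bsub>natural_order A\<^esub> b \<preceq> a"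
    "a \<sqinter>\<^bsub>natural_order A\<^esub> b \<preceq> b" "\<lbrakk>c \<in> carrier A; c \<preceq> a; c \<preceq> b\<rbrakk> \<Longrightarrow> c \<preceq> a \<sqinter>\<^bsub>natural_order A\<^esub> b"
    using S(1) * ** by auto
qed

end

section \<open>Open sublocales and isomorphisms of frames\<close>

lemma order_iso_sup:
  assumes "complete_lattice F" "complete_lattice G" "bij_betw \<phi> (carrier F) (carrier G)"
    and le: "\<And>x y. \<lbrakk>x \<in> carrier F; y \<in> carrier F\<rbrakk> \<Longrightarrow> x \<sqsubseteq>\<^bsub>F\<^esub> y \<longleftrightarrow> \<phi> x \<sqsubseteq>\<^bsub>G\<^esub> \<phi> y"
    and S: "S \<subseteq> carrier F"
  shows "\<phi> (\<Squnion>\<^bsub>F\<^esub> S) = \<Squnion>\<^bsub>G\<^esub> (\<phi> ` S)"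
proof -
  interpret F: complete_lattice F by fact
  interpret G: complete_lattice G by fact
  have \<phi>: "\<phi> ` carrier F = carrier G" using assms(3) by (simp add: bij_betw_def)
  show ?thesis
  proof (rule G.sup_eqI[symmetric])
    show "\<phi> (\<Squnion>\<^bsub>F\<^esub> S) \<in> carrier G" "\<phi> ` S \<subseteq> carrier G"
      using S \<phi> F.sup_closed[OF S] by blast+
    show "s \<sqsubseteq>\<^bsub>G\<^esub> \<phi> (\<Squnion>\<^bsub>F\<^esub> S)" if s: "s \<in> \<phi> ` S" for s
    proof -
      obtain r where r: "r \<in> S" "s = \<phi> r" using s by auto
      then show ?thesis using le[of r "\<Squnion>\<^bsub>F\<^esub> S"] S F.sup_upper[of S r] F.sup_closed[OF S] by auto
    qed
  next
    fix c assume c: "c \<in> carrier G" "\<And>s. s \<in> \<phi> ` S \<Longrightarrow> s \<sqsubseteq>\<^bsub>G\<^esub> c"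
    obtain d where d: "d \<in> carrier F" "c = \<phi> d" using c(1) \<phi> by auto
    have "\<Squnion>\<^bsub>F\<^esub> S \<sqsubseteq>\<^bsub>F\<^esub> d"
      using c(2) d S by (intro F.sup_least) (auto simp: le)
    then show "\<phi> (\<Squnion>\<^bsub>F\<^esub> S) \<sqsubseteq>\<^bsub>G\<^esub> c" using le d S by simp
  qed
qed

lemma order_iso_inf:
  assumes "complete_lattice F" "complete_lattice G" "bij_betw \<phi> (carrier F) (carrier G)"
    and le: "\<And>x y. \<lbrakk>x \<in> carrier F; y \<in> carrier F\<rbrakk> \<Longrightarrow> x \<sqsubseteq>\<^bsub>F\<^esub> y \<longleftrightarrow> \<phi> x \<sqsubseteq>\<^bsub>G\<^esub> \<phi> y"
    and S: "S \<subseteq> carrier F"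
  shows "\<phi> (\<Sqinter>\<^bsub>F\<^esub> S) = \<Sqinter>\<^bsub>G\<^esub> (\<phi> ` S)"
proof -
  interpret F: complete_lattice F by fact
  interpret G: complete_lattice G by fact
  have \<phi>: "\<phi> ` carrier F = carrier G" using assms(3) by (simp add: bij_betw_def)
  show ?thesis
  proof (rule G.inf_eqI[symmetric])
    show "\<phi> (\<Sqinter>\<^bsub>F\<^esub> S) \<in> carrier G" "\<phi> ` S \<subseteq> carrier G"
      using S \<phi> F.inf_closed[OF S] by blast+
    show "\<phi> (\<Sqinter>\<^bsub>F\<^esub> S) \<sqsubseteq>\<^bsub>G\<^esub> s" if s: "s \<in> \<phi> ` S" for s
    proof -
      obtain r where r: "r \<in> S" "s = \<phi> r" using s by auto
      then show ?thesis using le[of "\<Sqinter>\<^bsub>F\<^esub> S" r] S F.inf_lower[of S r] F.inf_closed[OF S] by auto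
    qed
  next
    fix c assume c: "c \<in> carrier G" "\<And>s. s \<in> \<phi> ` S \<Longrightarrow> c \<sqsubseteq>\<^bsub>G\<^esub> s"
    obtain d where d: "d \<in> carrier F" "c = \<phi> d" using c(1) \<phi> by auto
    have "d \<sqsubseteq>\<^bsub>F\<^esub> \<Sqinter>\<^bsub>F\<^esub> S"
      using c(2) d S by (intro F.inf_greatest) (auto simp: le)
    then show "c \<sqsubseteq>\<^bsub>G\<^esub> \<phi> (\<Sqinter>\<^bsub>F\<^esub> S)" using le d S by simp
  qed
qed

text \<open>The order is recovered from joins: \<open>x\<close> lies below \<open>y\<close>
  precisely when the join of the two is \<open>y\<close>.\<close>

lemma frame_hom_mono:
  assumes "frame_hom F G \<phi>" "x \<in> carrier F" "y \<in> carrier F" "x \<sqsubseteq>\<^bsub>F\<^esub> y"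
  shows "\<phi> x \<sqsubseteq>\<^bsub>G\<^esub> \<phi> y"
proof -
  interpret frame_hom F G \<phi> by fact
  have c: "\<phi> x \<in> carrier G" "\<phi> y \<in> carrier G" using frame_hom_closed assms by auto
  have "\<Squnion>\<^bsub>F\<^esub> {x, y} = y" using assms by (intro F.sup_eqI) auto
  then have "\<phi> y = \<Squnion>\<^bsub>G\<^esub> {\<phi> x, \<phi> y}" using frame_hom_Sup[of "{x, y}"] assms by auto
  then show ?thesis using G.sup_upper[of "{\<phi> x, \<phi> y}" "\<phi> x"] c by auto
qed

lemma order_iso_frame_hom:
  assumes "frame F" "frame G" "bij_betw \<phi> (carrier F) (carrier G)"
    and le: "\<And>x y. \<lbrakk>x \<in> carrier F; y \<in> carrier F\<rbrakk> \<Longrightarrow> x \<sqsubseteq>\<^bsub>F\<^esub> y \<longleftrightarrow> \<phi> x \<sqsubseteq>\<^bsub>G\<^esub> \<phi> y"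
  shows "frame_hom F G \<phi>"
proof -
  interpret F: frame F by fact
  interpret G: frame G by fact
  show ?thesis
  proof
    show "\<phi> \<in> carrier F \<rightarrow> carrier G" using assms(3) by (auto simp: bij_betw_def)
  qed (use order_iso_sup[OF F.complete_lattice_axioms G.complete_lattice_axioms assms(3) le]
      order_iso_inf[OF F.complete_lattice_axioms G.complete_lattice_axioms assms(3) le] in auto)
qed

text \<open>Joins and meets are determined by the order, so a bijection that preserves and reflects
  it is automatically a frame homomorphism in both directions. From here on partial homeomorphisms
  can be treated purely order-theoretically.\<close>

lemma frame_iso_iff:
  assumes F: "frame F" and G: "frame G"
  shows "frame_iso F G \<phi> \<longleftrightarrow> bij_betw \<phi> (carrier F) (carrier G) \<and>
    (\<forall>x\<in>carrier F. \<forall>y\<in>carrier F. x \<sqsubseteq>\<^bsub>F\<^esub> y \<longleftrightarrow> \<phi> x \<sqsubseteq>\<^bsub>G\<^esub> \<phi> y)" (is "_ \<longleftrightarrow> ?R")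
proof
  assume "frame_iso F G \<phi>"
  then obtain \<psi> where \<phi>: "frame_hom F G \<phi>" and \<psi>: "frame_hom G F \<psi>"
    and 1: "\<forall>x\<in>carrier F. \<psi> (\<phi> x) = x" and 2: "\<forall>y\<in>carrier G. \<phi> (\<psi> y) = y"
    unfolding frame_iso_def by auto
  note c = frame_hom.frame_hom_closed[OF \<phi>] frame_hom.frame_hom_closed[OF \<psi>]
  have "bij_betw \<phi> (carrier F) (carrier G)"
    using c 1 2 by (intro bij_betw_byWitness[where f' = \<psi>]) auto
  moreover have "x \<sqsubseteq>\<^bsub>F\<^esub> y \<longleftrightarrow> \<phi> x \<sqsubseteq>\<^bsub>G\<^esub> \<phi> y" if "x \<in> carrier F" "y \<in> carrier F" for x y
    using frame_hom_mono[OF \<phi> that] frame_hom_mono[OF \<psi>, of "\<phi> x" "\<phi> y"] c 1 that by auto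
  ultimately show ?R by auto
next
  assume R: ?R
  then have bij: "bij_betw \<phi> (carrier F) (carrier G)" by simp
  define \<psi> where "\<psi> = inv_into (carrier F) \<phi>"
  have bij': "bij_betw \<psi> (carrier G) (carrier F)" unfolding \<psi>_def using bij by (rule bij_betw_inv_into)
  have 2: "\<phi> (\<psi> y) = y" if "y \<in> carrier G" for y
    using that bij by (simp add: \<psi>_def bij_betw_inv_into_right)
  have 1: "\<psi> (\<phi> x) = x" if "x \<in> carrier F" for x
    using that bij by (simp add: \<psi>_def bij_betw_inv_into_left)
  have "frame_hom F G \<phi>" using R by (intro order_iso_frame_hom F G) auto
  moreover have "frame_hom G F \<psi>"
  proof (intro order_iso_frame_hom F G bij')
    fix x y assume xy: "x \<in> carrier G" "y \<in> carrier G"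
    then have "\<psi> x \<in> carrier F" "\<psi> y \<in> carrier F" using bij' by (auto simp: bij_betw_def)
    then show "x \<sqsubseteq>\<^bsub>G\<^esub> y \<longleftrightarrow> \<psi> x \<sqsubseteq>\<^bsub>F\<^esub> \<psi> y" using R 2 xy by auto
  qed
  ultimately show "frame_iso F G \<phi>" unfolding frame_iso_def using 1 2 by blast
qed

section \<open>Open sublocales are frames\<close>

context frame
begin

declare meet_left [simp, intro] meet_right [simp, intro]

lemma meet_le_trans:
  assumes "x \<in> carrier L" "y \<in> carrier L" "z \<in> carrier L" "x \<sqsubseteq> z"
  shows "x \<sqinter> y \<sqsubseteq> z" "y \<sqinter> x \<sqsubseteq> z"
  using assms le_trans[of "x \<sqinter> y" x z] le_trans[of "y \<sqinter> x" x z] by auto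

lemma le_sup:
  assumes "S \<subseteq> carrier L" "s \<in> S" "x \<sqsubseteq> s" "x \<in> carrier L"
  shows "x \<sqsubseteq> \<Squnion>S"
  using assms le_trans[of x s "\<Squnion>S"] sup_upper[of S s] by auto

abbreviation down where "down u \<equiv> carrier (open_sublocale L u)"

lemma down_iff [simp]: "x \<in> down u \<longleftrightarrow> x \<in> carrier L \<and> x \<sqsubseteq> u"
  by (simp add: open_sublocale_def)

lemma le_open_sublocale [simp]: "x \<sqsubseteq>\<^bsub>open_sublocale L u\<^esub> y \<longleftrightarrow> x \<sqsubseteq> y"
  by (simp add: open_sublocale_def)

lemma partial_order_open_sublocale: "partial_order (open_sublocale L u)"
  by unfold_locales (auto simp: open_sublocale_def eq_is_equal intro: le_trans)

lemma sup_open_sublocale: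
  assumes u: "u \<in> carrier L" and S: "S \<subseteq> down u"
  shows "\<Squnion>S \<in> down u" "least (open_sublocale L u) (\<Squnion>S) (Upper (open_sublocale L u) S)"
    "\<Squnion>\<^bsub>open_sublocale L u\<^esub> S = \<Squnion>S"
proof -
  interpret D: partial_order "open_sublocale L u" by (rule partial_order_open_sublocale)
  have S': "S \<subseteq> carrier L" using S by auto
  show 1: "\<Squnion>S \<in> down u" using S S' u by (auto intro!: sup_least)
  show "least (open_sublocale L u) (\<Squnion>S) (Upper (open_sublocale L u) S)"
    using S S' 1 by (intro least_UpperI) (auto intro!: sup_upper sup_least simp: Upper_def)
  show "\<Squnion>\<^bsub>open_sublocale L u\<^esub> S = \<Squnion>S"
    using S S' 1 by (intro D.sup_eqI) (auto intro!: sup_upper sup_least)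
qed

text \<open>Inserting \<open>u\<close> matters for empty \<open>S\<close>: the empty meet of the
  sublocale is \<open>u\<close>, not the top of the ambient frame.\<close>

lemma inf_open_sublocale:
  assumes u: "u \<in> carrier L" and S: "S \<subseteq> down u"
  shows "greatest (open_sublocale L u) (\<Sqinter>(insert u S)) (Lower (open_sublocale L u) S)"
proof -
  have S': "insert u S \<subseteq> carrier L" using S u by auto
  then have 1: "\<Sqinter>(insert u S) \<in> down u" by (auto intro!: inf_lower)
  show ?thesis
    using S S' 1 by (intro greatest_LowerI) (auto intro!: inf_lower inf_greatest simp: Lower_def)
qed

lemma meet_open_sublocale:
  assumes "x \<in> down u" "y \<in> down u" "u \<in> carrier L"
  shows "x \<sqinter>\<^bsub>open_sublocale L u\<^esub> y = x \<sqinter> y"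
proof -
  interpret D: partial_order "open_sublocale L u" by (rule partial_order_open_sublocale)
  show ?thesis
    using assms meet_left[of x y] meet_right[of x y]
    by (intro D.meet_eqI) (auto intro: meet_le le_trans)
qed

lemma frame_open_sublocale:
  assumes u: "u \<in> carrier L"
  shows "frame (open_sublocale L u)"
proof -
  interpret D: partial_order "open_sublocale L u" by (rule partial_order_open_sublocale)
  show ?thesis
  proof
    fix S assume S: "S \<subseteq> down u"
    show "\<exists>s. least (open_sublocale L u) s (Upper (open_sublocale L u) S)"
      using sup_open_sublocale[OF u S] by blast
    show "\<exists>s. greatest (open_sublocale L u) s (Lower (open_sublocale L u) S)"
      using inf_open_sublocale[OF u S] by blast
  next
    fix a B assume a: "a \<in> down u" and B: "B \<subseteq> down u"
    have B': "B \<subseteq> carrier L" using B by auto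
    have "a \<sqinter> b \<in> down u" if "b \<in> B" for b
      using a u meet_le_trans(1)[of a b u] subsetD[OF B' that] by simp
    then have "(\<lambda>b. a \<sqinter> b) ` B \<subseteq> down u" by blast
    moreover have "(\<lambda>b. a \<sqinter>\<^bsub>open_sublocale L u\<^esub> b) ` B = (\<lambda>b. a \<sqinter> b) ` B"
      using a B u by (intro image_cong refl meet_open_sublocale) auto
    ultimately show "a \<sqinter>\<^bsub>open_sublocale L u\<^esub> \<Squnion>\<^bsub>open_sublocale L u\<^esub> B =
        \<Squnion>\<^bsub>open_sublocale L u\<^esub> ((\<lambda>b. a \<sqinter>\<^bsub>open_sublocale L u\<^esub> b) ` B)"
      using a B B' u meet_open_sublocale[OF a, of "\<Squnion>B"] meet_Sup_distrib[of a B]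
        sup_open_sublocale[OF u B] sup_open_sublocale[OF u, of "(\<lambda>b. a \<sqinter> b) ` B"]
      by auto
  qed
qed

text \<open>The distributive law in the shape used for gluing: an open under a cover is recomposed
  from its traces on the cover.\<close>

lemma le_Sup_distrib:
  assumes "x \<in> carrier L" "B \<subseteq> carrier L" "x \<sqsubseteq> \<Squnion>B"
  shows "\<Squnion>((\<lambda>b. x \<sqinter> b) ` B) = x"
  unfolding meet_Sup_distrib[OF assms(1,2), symmetric]
  using assms by (intro meet_eqI) auto

end

section \<open>Isomorphisms between principal ideals of a frame\<close>

context frame
begin

text \<open>An order isomorphism from \<open>down u\<close> onto \<open>down v\<close>, encoded as a
  relation so that passing to the inverse is mere conversion and restriction is inclusion.
  Single-valuedness in both directions is a consequence of the last clause and antisymmetry.\<close>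

definition principal_iso :: "'a \<Rightarrow> 'a \<Rightarrow> ('a \<times> 'a) set \<Rightarrow> bool" where
  "principal_iso u v R \<longleftrightarrow> u \<in> carrier L \<and> v \<in> carrier L \<and> R \<subseteq> down u \<times> down v \<and>
     (\<forall>x\<in>down u. \<exists>y. (x, y) \<in> R) \<and> (\<forall>y\<in>down v. \<exists>x. (x, y) \<in> R) \<and>
     (\<forall>x y x' y'. (x, y) \<in> R \<longrightarrow> (x', y') \<in> R \<longrightarrow> (x \<sqsubseteq> x' \<longleftrightarrow> y \<sqsubseteq> y'))"

lemma principal_iso_converse: "principal_iso u v R \<Longrightarrow> principal_iso v u (R\<inverse>)"
  unfolding principal_iso_def by blast

context
  fixes u v R assumes R: "principal_iso u v R"
begin

lemma principal_isoD:
  "u \<in> carrier L" "v \<in> carrier L"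
  "(x, y) \<in> R \<Longrightarrow> x \<in> carrier L" "(x, y) \<in> R \<Longrightarrow> y \<in> carrier L"
  "(x, y) \<in> R \<Longrightarrow> x \<sqsubseteq> u" "(x, y) \<in> R \<Longrightarrow> y \<sqsubseteq> v"
  "(x, y) \<in> R \<Longrightarrow> (x', y') \<in> R \<Longrightarrow> x \<sqsubseteq> x' \<longleftrightarrow> y \<sqsubseteq> y'"
  using R unfolding principal_iso_def by auto

lemma principal_iso_image: "x \<in> carrier L \<Longrightarrow> x \<sqsubseteq> u \<Longrightarrow> \<exists>y. (x, y) \<in> R"
  and principal_iso_preimage: "y \<in> carrier L \<Longrightarrow> y \<sqsubseteq> v \<Longrightarrow> \<exists>x. (x, y) \<in> R"
  using R unfolding principal_iso_def by auto

lemma principal_iso_functional: "(x, y) \<in> R \<Longrightarrow> (x, y') \<in> R \<Longrightarrow> y = y'"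
  and principal_iso_injective: "(x, y) \<in> R \<Longrightarrow> (x', y) \<in> R \<Longrightarrow> x = x'"
proof -
  assume a: "(x, y) \<in> R" and b: "(x, y') \<in> R"
  show "y = y'"
    using principal_isoD(7)[OF a b] principal_isoD(7)[OF b a] principal_isoD(3,4)[OF a]
      principal_isoD(4)[OF b] le_antisym[of y y'] by simp
next
  assume a: "(x, y) \<in> R" and b: "(x', y) \<in> R"
  show "x = x'"
    using principal_isoD(7)[OF a b] principal_isoD(7)[OF b a] principal_isoD(3,4)[OF a]
      principal_isoD(3)[OF b] le_antisym[of x x'] by simp
qed

text \<open>Top corresponds to top: the partner of \<open>u\<close> lies below \<open>v\<close>, so
  the partner \<open>x\<close> of \<open>v\<close> lies above \<open>u\<close>.\<close>

lemma principal_iso_ends: "(u, v) \<in> R"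
proof -
  obtain x where x: "(x, v) \<in> R" using principal_iso_preimage principal_isoD(2) by blast
  obtain y where y: "(u, y) \<in> R" using principal_iso_image principal_isoD(1) by blast
  have "u \<sqsubseteq> x" using principal_isoD(7)[OF y x] principal_isoD(6)[OF y] by simp
  then have "x = u" using principal_isoD(3,5)[OF x] principal_isoD(1) by (intro le_antisym)
  then show ?thesis using x by simp
qed

lemma principal_iso_image_below:
  assumes "(x, y) \<in> R" "x' \<in> carrier L" "x' \<sqsubseteq> x"
  obtains y' where "(x', y') \<in> R" "y' \<sqsubseteq> y"
proof -
  have "x' \<sqsubseteq> u" using assms principal_isoD(1,3,5) le_trans by blast
  then obtain y' where y': "(x', y') \<in> R" using principal_iso_image assms by blast
  then show thesis using that principal_isoD(7)[OF y' assms(1)] assms(3) by simp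
qed

text \<open>Let \<open>y\<close> be the partner of the left join and \<open>x\<close> that of the
  right join. Then \<open>y\<close> bounds the right components and \<open>x\<close> the left ones,
  and comparing the two pairs forces \<open>y\<close> to be the right join.\<close>

lemma principal_iso_sup:
  assumes T: "T \<subseteq> R"
  shows "(\<Squnion>(fst ` T), \<Squnion>(snd ` T)) \<in> R"
proof -
  have TR: "(fst p, snd p) \<in> R" if "p \<in> T" for p using T that by auto
  have c: "fst ` T \<subseteq> carrier L" "snd ` T \<subseteq> carrier L"
    using principal_isoD(3,4)[OF TR] by blast+
  have "\<Squnion>(fst ` T) \<sqsubseteq> u" "\<Squnion>(snd ` T) \<sqsubseteq> v"
    using principal_isoD(5,6)[OF TR] by (intro sup_least c principal_isoD(1,2); elim imageE; simp)+
  then obtain x y where y: "(\<Squnion>(fst ` T), y) \<in> R" and x: "(x, \<Squnion>(snd ` T)) \<in> R"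
    using c principal_iso_image principal_iso_preimage by (meson sup_closed)
  note cl = principal_isoD(3,4)[OF y] principal_isoD(3,4)[OF x]
  have "\<Squnion>(snd ` T) \<sqsubseteq> y"
  proof (rule sup_least)
    fix b assume "b \<in> snd ` T"
    then obtain a where ab: "(a, b) \<in> T" by auto
    then have "a \<sqsubseteq> \<Squnion>(fst ` T)" using sup_upper[OF c(1) imageI[OF ab]] by simp
    then show "b \<sqsubseteq> y" using principal_isoD(7)[OF subsetD[OF T ab] y] by simp
  qed (use c cl in auto)
  moreover have "\<Squnion>(fst ` T) \<sqsubseteq> x"
  proof (rule sup_least)
    fix a assume "a \<in> fst ` T"
    then obtain b where ab: "(a, b) \<in> T" by auto
    then have "b \<sqsubseteq> \<Squnion>(snd ` T)" using sup_upper[OF c(2) imageI[OF ab]] by simp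
    then show "a \<sqsubseteq> x" using principal_isoD(7)[OF subsetD[OF T ab] x] by simp
  qed (use c cl in auto)
  then have "y \<sqsubseteq> \<Squnion>(snd ` T)" using principal_isoD(7)[OF y x] by simp
  ultimately have "y = \<Squnion>(snd ` T)" using cl by auto
  then show ?thesis using y by simp
qed

end

text \<open>A relation remembers its source and target as the components of its largest pair, so a
  graph determines them.\<close>

lemma principal_iso_bounds_unique:
  assumes R: "principal_iso u v R" and R': "principal_iso u' v' R"
  shows "u = u'" "v = v'"
  by (rule le_antisym principal_isoD[OF R] principal_isoD[OF R'] principal_iso_ends[OF R] principal_iso_ends[OF R'])+

section \<open>Gluing compatible families of isomorphisms\<close>

text \<open>The glued relation is stated symmetrically in source and
  target, so that its properties only have to be checked in one direction.\<close>

definition glue :: "'i set \<Rightarrow> ('i \<Rightarrow> 'a) \<Rightarrow> ('i \<Rightarrow> 'a) \<Rightarrow> ('i \<Rightarrow> ('a \<times> 'a) set) \<Rightarrow> ('a \<times> 'a) set" where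
  "glue I s t R = {(x, y). x \<in> down (\<Squnion>(s ` I)) \<and> y \<in> down (\<Squnion>(t ` I)) \<and>
    (\<forall>i\<in>I. (x \<sqinter> s i, y \<sqinter> t i) \<in> R i)}"

text \<open>The last two clauses are joint compatibility read on graphs: agreement on opens in two
  sources, and on opens in two targets. Conversion swaps them.\<close>

definition compatible_family :: "'i set \<Rightarrow> ('i \<Rightarrow> 'a) \<Rightarrow> ('i \<Rightarrow> 'a) \<Rightarrow> ('i \<Rightarrow> ('a \<times> 'a) set) \<Rightarrow> bool" where
  "compatible_family I s t R \<longleftrightarrow> (\<forall>i\<in>I. principal_iso (s i) (t i) (R i)) \<and>
    (\<forall>i\<in>I. \<forall>j\<in>I. \<forall>x y y'. (x, y) \<in> R i \<longrightarrow> (x, y') \<in> R j \<longrightarrow> y = y') \<and>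
    (\<forall>i\<in>I. \<forall>j\<in>I. \<forall>x x' y. (x, y) \<in> R i \<longrightarrow> (x', y) \<in> R j \<longrightarrow> x = x')"

lemma compatible_family_converse:
  "compatible_family I s t R \<Longrightarrow> compatible_family I t s (\<lambda>i. (R i)\<inverse>)"
  unfolding compatible_family_def using principal_iso_converse by (intro conjI; blast)

lemma glue_converse: "glue I t s (\<lambda>i. (R i)\<inverse>) = (glue I s t R)\<inverse>"
  by (auto simp: glue_def)

context
  fixes I s t R assumes fam: "compatible_family I s t R"
begin

lemma family_iso: "i \<in> I \<Longrightarrow> principal_iso (s i) (t i) (R i)"
  and family_functional: "\<lbrakk>i \<in> I; j \<in> I; (x, y) \<in> R i; (x, y') \<in> R j\<rbrakk> \<Longrightarrow> y = y'"
  and family_injective: "\<lbrakk>i \<in> I; j \<in> I; (x, y) \<in> R i; (x', y) \<in> R j\<rbrakk> \<Longrightarrow> x = x'"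
  using fam unfolding compatible_family_def by blast+

lemma family_closed: "i \<in> I \<Longrightarrow> s i \<in> carrier L" "i \<in> I \<Longrightarrow> t i \<in> carrier L"
  "s ` I \<subseteq> carrier L" "t ` I \<subseteq> carrier L"
  using family_iso principal_isoD(1,2) by blast+

text \<open>An open inside two targets has a preimage under each of the two maps, and compatibility
  says that these preimages coincide.\<close>

lemma family_overlap:
  assumes ij: "i \<in> I" "j \<in> I" and xy: "(x, y) \<in> R i" and z: "z \<in> carrier L" "z \<sqsubseteq> y" "z \<sqsubseteq> t j"
  obtains w where "(w, z) \<in> R i" "(w, z) \<in> R j" "w \<sqsubseteq> x" "w \<sqsubseteq> s j" "w \<in> carrier L"
proof -
  have "(y, x) \<in> (R i)\<inverse>" using xy by simp
  from principal_iso_image_below[OF principal_iso_converse[OF family_iso[OF ij(1)]] this z(1,2)]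
  obtain w where w: "(w, z) \<in> R i" "w \<sqsubseteq> x" by auto
  obtain w' where w': "(w', z) \<in> R j" using principal_iso_preimage[OF family_iso[OF ij(2)] z(1,3)] by auto
  have "w = w'" using family_injective[OF ij w(1) w'] .
  with w w' show thesis using that principal_isoD(3,5)[OF family_iso[OF ij(2)] w'] by auto
qed

text \<open>Let \<open>w\<close> be the partner of \<open>y \<sqinter> t j\<close> and
  \<open>z\<close> that of \<open>x \<sqinter> s j\<close>, both under \<open>R j\<close>. Passing
  through \<open>R i\<close> shows \<open>w\<close> below \<open>x \<sqinter> s j\<close> and
  \<open>z\<close> below \<open>y \<sqinter> t j\<close>; the second fact, pulled back along
  \<open>R j\<close>, reverses the first.\<close>

lemma family_restrict:
  assumes ij: "i \<in> I" "j \<in> I" and xy: "(x, y) \<in> R i"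
  shows "(x \<sqinter> s j, y \<sqinter> t j) \<in> R j"
proof -
  note c = family_closed(1,2)[OF ij(2)] principal_isoD(3,4)[OF family_iso[OF ij(1)] xy]
  obtain w where w: "(w, y \<sqinter> t j) \<in> R j" "w \<sqsubseteq> x" "w \<sqsubseteq> s j" "w \<in> carrier L"
    using family_overlap[OF ij xy meet_closed[OF c(4,2)] meet_left[OF c(4,2)] meet_right[OF c(4,2)]] .
  obtain z where z: "(x \<sqinter> s j, z) \<in> R j" using principal_iso_image[OF family_iso[OF ij(2)], of "x \<sqinter> s j"] c by auto
  obtain z' where z': "(x \<sqinter> s j, z') \<in> R i" "z' \<sqsubseteq> y"
    using principal_iso_image_below[OF family_iso[OF ij(1)] xy, of "x \<sqinter> s j"] c by auto
  have "z = z'" using family_functional[OF ij(2,1) z z'(1)] .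
  with z' have "z \<sqsubseteq> y" by simp
  note R = principal_isoD[OF family_iso[OF ij(2)]]
  have "z \<sqsubseteq> y \<sqinter> t j" using R(4,6)[OF z] \<open>z \<sqsubseteq> y\<close> c by (intro meet_le) auto
  moreover have "w \<sqsubseteq> x \<sqinter> s j" using w c by (intro meet_le) auto
  ultimately have "w = x \<sqinter> s j" using R(7)[OF z w(1)] w(4) c by auto
  then show ?thesis using w(1) by simp
qed

lemma subset_glue: "i \<in> I \<Longrightarrow> R i \<subseteq> glue I s t R"
proof
  fix p assume i: "i \<in> I" and p: "p \<in> R i"
  obtain x y where xy: "p = (x, y)" by fastforce
  note R = principal_isoD[OF family_iso[OF i]]
  have "x \<sqsubseteq> \<Squnion>(s ` I)"
    using R(3,5)[OF p[unfolded xy]] i family_closed(3) by (intro le_sup[of _ "s i"]) auto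
  moreover have "y \<sqsubseteq> \<Squnion>(t ` I)"
    using R(4,6)[OF p[unfolded xy]] i family_closed(4) by (intro le_sup[of _ "t i"]) auto
  ultimately show "p \<in> glue I s t R"
    using xy p i R(3,4)[OF p[unfolded xy]] family_restrict[OF i] by (auto simp: glue_def)
qed

text \<open>Monotonicity is local: \<open>y\<close> is the join of its traces
  \<open>y \<sqinter> t i\<close>, and each trace is compared inside \<open>R i\<close>.\<close>

lemma glue_mono:
  assumes xy: "(x, y) \<in> glue I s t R" "(x', y') \<in> glue I s t R" and "x \<sqsubseteq> x'"
  shows "y \<sqsubseteq> y'"
proof -
  have c: "x \<in> carrier L" "y \<in> carrier L" "x' \<in> carrier L" "y' \<in> carrier L" "y \<sqsubseteq> \<Squnion>(t ` I)"
    using xy by (auto simp: glue_def)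
  have "\<Squnion>((\<lambda>b. y \<sqinter> b) ` t ` I) \<sqsubseteq> y'"
  proof (rule sup_least)
    fix b assume "b \<in> (\<lambda>b. y \<sqinter> b) ` t ` I"
    then obtain i where i: "i \<in> I" and b: "b = y \<sqinter> t i" by auto
    have R: "(x \<sqinter> s i, y \<sqinter> t i) \<in> R i" "(x' \<sqinter> s i, y' \<sqinter> t i) \<in> R i"
      using xy i by (auto simp: glue_def)
    have "x \<sqinter> s i \<sqsubseteq> x' \<sqinter> s i"
      using c family_closed(1)[OF i] \<open>x \<sqsubseteq> x'\<close> by (auto intro!: meet_le intro: meet_le_trans)
    then have "y \<sqinter> t i \<sqsubseteq> y' \<sqinter> t i" using principal_isoD(7)[OF family_iso[OF i] R] by simp
    then show "b \<sqsubseteq> y'"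
      using b c family_closed(2)[OF i] le_trans[of "y \<sqinter> t i" "y' \<sqinter> t i" y'] by auto
  qed (use c family_closed(2) in auto)
  then show ?thesis using le_Sup_distrib[OF c(2) family_closed(4) c(5)] by simp
qed

text \<open>The partner of \<open>x\<close> is the join of the local images \<open>z i\<close> of
  the traces \<open>x \<sqinter> s i\<close>.\<close>

lemma glue_total:
  assumes x: "x \<in> carrier L" "x \<sqsubseteq> \<Squnion>(s ` I)"
  shows "\<exists>y. (x, y) \<in> glue I s t R"
proof -
  have "\<exists>z. (x \<sqinter> s i, z) \<in> R i" if "i \<in> I" for i
    using that x family_closed(1) by (intro principal_iso_image[OF family_iso]) auto
  then obtain z where z: "(x \<sqinter> s i, z i) \<in> R i" if "i \<in> I" for i by metis
  have zc: "z i \<in> carrier L" "z i \<sqsubseteq> t i" if "i \<in> I" for i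
    using principal_isoD(4,6)[OF family_iso[OF that] z[OF that]] by auto
  then have zI: "z ` I \<subseteq> carrier L" by auto
  define y where "y = \<Squnion>(z ` I)"
  have yc: "y \<in> carrier L" unfolding y_def using zI by auto
  have zy: "z i \<sqsubseteq> y" if "i \<in> I" for i unfolding y_def using zI that by (intro sup_upper) auto
  have "y \<sqsubseteq> \<Squnion>(t ` I)"
    unfolding y_def using zI zc family_closed(4)
    by (intro sup_least) (auto intro!: le_sup)
  moreover have "(x \<sqinter> s i, y \<sqinter> t i) \<in> R i" if i: "i \<in> I" for i
  proof -
    \<comment> \<open>The other pieces must not enlarge the trace on \<open>t i\<close>. After
      distributing, each \<open>t i \<sqinter> z j\<close> lies in two targets; its common preimage
      \<open>w\<close> is below both \<open>x\<close> and \<open>s i\<close>, so \<open>R i\<close>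
      sends it below \<open>z i\<close>.\<close>
    have "t i \<sqinter> y \<sqsubseteq> z i"
      unfolding y_def meet_Sup_distrib[OF family_closed(2)[OF i] zI]
    proof (rule sup_least)
      fix b assume "b \<in> (\<lambda>b. t i \<sqinter> b) ` z ` I"
      then obtain j where j: "j \<in> I" and b: "b = t i \<sqinter> z j" by auto
      note c = family_closed(1,2)[OF i] family_closed(1,2)[OF j] zc[OF i] zc[OF j]
      have "b \<in> carrier L" "b \<sqsubseteq> z j" "b \<sqsubseteq> t i" using b c by auto
      from family_overlap[OF j i z[OF j] this]
      obtain w where w: "(w, b) \<in> R i" "w \<sqsubseteq> x \<sqinter> s j" "w \<sqsubseteq> s i" "w \<in> carrier L" by metis
      have "w \<sqsubseteq> x" using w x c le_trans[of w "x \<sqinter> s j" x] by auto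
      then have "w \<sqsubseteq> x \<sqinter> s i" using w x c by (auto intro: meet_le)
      then show "b \<sqsubseteq> z i" using principal_isoD(7)[OF family_iso[OF i] w(1) z[OF i]] by simp
    qed (use zI zc[OF i] family_closed(1,2)[OF i] in \<open>auto intro!: meet_closed\<close>)
    moreover have "z i \<sqsubseteq> y \<sqinter> t i"
      using zc[OF i] zy[OF i] yc family_closed(1,2)[OF i] by (intro meet_le) auto
    ultimately have "y \<sqinter> t i = z i"
      using zc[OF i] yc family_closed(1,2)[OF i] meet_comm by (metis le_antisym meet_closed)
    then show ?thesis using z[OF i] by simp
  qed
  ultimately show ?thesis using x yc by (auto simp: glue_def)
qed

end

lemma principal_iso_glue:
  assumes fam: "compatible_family I s t R"
  shows "principal_iso (\<Squnion>(s ` I)) (\<Squnion>(t ` I)) (glue I s t R)"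
proof -
  note fam' = compatible_family_converse[OF fam]
  show ?thesis
    unfolding principal_iso_def
  proof (intro conjI ballI allI impI)
    show "\<Squnion>(s ` I) \<in> carrier L" "\<Squnion>(t ` I) \<in> carrier L"
      using family_closed(3,4)[OF fam] by auto
    show "glue I s t R \<subseteq> down (\<Squnion>(s ` I)) \<times> down (\<Squnion>(t ` I))" by (auto simp: glue_def)
  next
    fix x assume "x \<in> down (\<Squnion>(s ` I))"
    then show "\<exists>y. (x, y) \<in> glue I s t R" using glue_total[OF fam] by auto
  next
    fix y assume "y \<in> down (\<Squnion>(t ` I))"
    then show "\<exists>x. (x, y) \<in> glue I s t R"
      using glue_total[OF fam', of y] unfolding glue_converse by auto
  next
    fix x y x' y' assume xy: "(x, y) \<in> glue I s t R" "(x', y') \<in> glue I s t R"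
    show "x \<sqsubseteq> x' \<longleftrightarrow> y \<sqsubseteq> y'"
      using glue_mono[OF fam xy] glue_mono[OF fam', of y x y' x'] xy unfolding glue_converse by auto
  qed
qed

text \<open>Separation: every pair of \<open>F\<close> is a join of pairs taken from the
  \<open>R i\<close>, and such a join belongs to \<open>G\<close> as well. This supplies the
  leastness of glued joins.\<close>

lemma principal_iso_subset_of_cover:
  assumes F: "principal_iso u v F" and G: "principal_iso u' v' G"
    and fam: "\<And>i. i \<in> I \<Longrightarrow> principal_iso (s i) (t i) (R i)"
    and RF: "\<And>i. i \<in> I \<Longrightarrow> R i \<subseteq> F" and RG: "\<And>i. i \<in> I \<Longrightarrow> R i \<subseteq> G" and u: "u \<sqsubseteq> \<Squnion>(s ` I)"
  shows "F \<subseteq> G"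
proof
  fix p assume p: "p \<in> F"
  obtain x y where xy: "p = (x, y)" by fastforce
  have xF: "(x, y) \<in> F" using p xy by simp
  have s: "s i \<in> carrier L" if "i \<in> I" for i using principal_isoD(1)[OF fam[OF that]] .
  then have sI: "s ` I \<subseteq> carrier L" by auto
  have xc: "x \<in> carrier L" "x \<sqsubseteq> u" using principal_isoD(3,5)[OF F xF] .
  then have x: "x \<sqsubseteq> \<Squnion>(s ` I)" using u principal_isoD(1)[OF F] sI le_trans[of x u] by auto
  have "\<exists>z. (x \<sqinter> s i, z) \<in> R i" if "i \<in> I" for i
    using xc s[OF that] by (intro principal_iso_image[OF fam[OF that]]) auto
  then obtain z where z: "(x \<sqinter> s i, z i) \<in> R i" if "i \<in> I" for i by metis
  define T where "T = (\<lambda>i. (x \<sqinter> s i, z i)) ` I"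
  have "T \<subseteq> F" "T \<subseteq> G" using z RF RG by (fastforce simp: T_def)+
  have "fst ` T = (\<lambda>b. x \<sqinter> b) ` s ` I" by (auto simp: T_def image_image)
  then have "\<Squnion>(fst ` T) = x" using le_Sup_distrib[OF xc(1) sI x] by simp
  then have "(x, \<Squnion>(snd ` T)) \<in> F" "(x, \<Squnion>(snd ` T)) \<in> G"
    using principal_iso_sup[OF F \<open>T \<subseteq> F\<close>] principal_iso_sup[OF G \<open>T \<subseteq> G\<close>] by auto
  then show "p \<in> G" using principal_iso_functional[OF F xF] xy by auto
qed

end

section \<open>Partial homeomorphisms form a pseudogroup\<close>

text \<open>Pairs list the open of the source first although \<open>pullback\<close> runs backwards,
  so a graph is read in the direction of the homeomorphism.\<close>

definition phomeo_graph :: "('a, 'm) gorder_scheme \<Rightarrow> 'a phomeo \<Rightarrow> ('a \<times> 'a) set" where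
  "phomeo_graph L f = (\<lambda>y. (pullback f y, y)) ` carrier (open_sublocale L (target f))"

context frame
begin

lemma phomeos_iff:
  "f \<in> phomeos L \<longleftrightarrow> source f \<in> carrier L \<and> target f \<in> carrier L \<and>
    pullback f \<in> extensional (down (target f)) \<and>
    bij_betw (pullback f) (down (target f)) (down (source f)) \<and>
    (\<forall>x\<in>down (target f). \<forall>y\<in>down (target f). x \<sqsubseteq> y \<longleftrightarrow> pullback f x \<sqsubseteq> pullback f y)"
  unfolding phomeos_def using frame_iso_iff[OF frame_open_sublocale frame_open_sublocale] by auto

lemma mem_phomeo_graph:
  "(x, y) \<in> phomeo_graph L f \<longleftrightarrow> y \<in> carrier L \<and> y \<sqsubseteq> target f \<and> x = pullback f y"
  by (auto simp: phomeo_graph_def)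

lemma principal_iso_graph:
  assumes "f \<in> phomeos L"
  shows "principal_iso (source f) (target f) (phomeo_graph L f)"
proof -
  have f: "source f \<in> carrier L" "target f \<in> carrier L"
    and im: "pullback f ` down (target f) = down (source f)"
    and le: "\<And>x y. x \<in> down (target f) \<Longrightarrow> y \<in> down (target f) \<Longrightarrow> x \<sqsubseteq> y \<longleftrightarrow> pullback f x \<sqsubseteq> pullback f y"
    using assms unfolding phomeos_iff bij_betw_def by auto
  show ?thesis
    unfolding principal_iso_def
  proof (intro conjI f ballI allI impI)
    show "phomeo_graph L f \<subseteq> down (source f) \<times> down (target f)"
      unfolding phomeo_graph_def using im by blast
    show "\<exists>y. (x, y) \<in> phomeo_graph L f" if "x \<in> down (source f)" for x
      using that unfolding im[symmetric] phomeo_graph_def by blast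
    show "\<exists>x. (x, y) \<in> phomeo_graph L f" if "y \<in> down (target f)" for y
      using that unfolding phomeo_graph_def by blast
    show "x \<sqsubseteq> x' \<longleftrightarrow> y \<sqsubseteq> y'" if "(x, y) \<in> phomeo_graph L f" "(x', y') \<in> phomeo_graph L f" for x y x' y'
      using that le[of y y'] by (simp add: mem_phomeo_graph)
  qed
qed

lemma phomeo_graph_inj:
  assumes f: "f \<in> phomeos L" and g: "g \<in> phomeos L" and eq: "phomeo_graph L f = phomeo_graph L g"
  shows "f = g"
proof -
  note st = principal_iso_bounds_unique[OF principal_iso_graph[OF f] principal_iso_graph[OF g, folded eq]]
  have "pullback f = pullback g"
  proof (rule extensionalityI)
    show "pullback f \<in> extensional (down (target f))" "pullback g \<in> extensional (down (target f))"
      using f g st unfolding phomeos_iff by auto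
    fix y assume "y \<in> down (target f)"
    then have "(pullback f y, y) \<in> phomeo_graph L f" by (simp add: mem_phomeo_graph)
    then show "pullback f y = pullback g y" unfolding eq mem_phomeo_graph by simp
  qed
  then show ?thesis using st by (intro phomeo.equality) auto
qed

text \<open>Together with \<open>phomeo_graph_inj\<close> this identifies partial homeomorphisms
  with principal isomorphisms, so inverses and joins may be constructed as relations.\<close>

lemma phomeo_of_principal_iso:
  assumes R: "principal_iso u v R"
  shows "\<exists>f\<in>phomeos L. source f = u \<and> target f = v \<and> phomeo_graph L f = R"
proof -
  \<comment> \<open>Restricting makes the chosen inverse image map extensional, as membership in
    \<open>phomeos\<close> demands.\<close>
  define p where "p = restrict (\<lambda>y. SOME x. (x, y) \<in> R) (down v)"
  have p: "(p y, y) \<in> R" if "y \<in> down v" for y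
    using that principal_iso_preimage[OF R, of y] unfolding p_def by (auto intro: someI_ex)
  define f where "f = \<lparr>source = u, target = v, pullback = p\<rparr>"
  have g: "phomeo_graph L f = R"
  proof (intro subset_antisym subrelI)
    fix x y assume "(x, y) \<in> phomeo_graph L f"
    then show "(x, y) \<in> R" using p by (simp add: mem_phomeo_graph f_def)
  next
    fix x y assume xy: "(x, y) \<in> R"
    then have "y \<in> down v" using principal_isoD[OF R] by simp
    then show "(x, y) \<in> phomeo_graph L f"
      using principal_iso_injective[OF R xy p] by (simp add: mem_phomeo_graph f_def)
  qed
  have "f \<in> phomeos L"
    unfolding phomeos_iff
  proof (intro conjI)
    show "source f \<in> carrier L" "target f \<in> carrier L" using principal_isoD(1,2)[OF R] by (auto simp: f_def)
    show "pullback f \<in> extensional (down (target f))" by (simp add: f_def p_def)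
    show "\<forall>x\<in>down (target f). \<forall>y\<in>down (target f). x \<sqsubseteq> y \<longleftrightarrow> pullback f x \<sqsubseteq> pullback f y"
      using principal_isoD(7)[OF R p p] by (simp add: f_def)
    have "inj_on p (down v)"
      using principal_iso_functional[OF R p] p by (intro inj_onI) metis
    moreover have "p ` down v = down u"
    proof (intro subset_antisym subsetI)
      fix x assume "x \<in> p ` down v"
      then show "x \<in> down u" using principal_isoD(3,5)[OF R p] by auto
    next
      fix x assume "x \<in> down u"
      then obtain y where y: "(x, y) \<in> R" using principal_iso_image[OF R, of x] by auto
      then have "y \<in> down v" using principal_isoD[OF R] by simp
      then show "x \<in> p ` down v" using principal_iso_injective[OF R y p] by blast
    qed
    ultimately show "bij_betw (pullback f) (down (target f)) (down (source f))"
      by (simp add: bij_betw_def f_def)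
  qed
  then show ?thesis using g by (intro bexI[where x = f]) (auto simp: f_def)
qed

text \<open>A pair passing through both maps has its middle open below the meeting open
  \<open>m\<close>, so the explicit source and target cut off nothing. The third clause locates the
  source of the composite; sources of joins of products are computed from it.\<close>

lemma phomeo_comp_graph:
  assumes f: "f \<in> phomeos L" and g: "g \<in> phomeos L"
  shows "phomeo_comp L f g \<in> phomeos L"
    and "phomeo_graph L (phomeo_comp L f g) = phomeo_graph L g O phomeo_graph L f"
    and "(source (phomeo_comp L f g), source f \<sqinter> target g) \<in> phomeo_graph L g"
proof -
  define m where "m = source f \<sqinter> target g"
  define w where "w = inv_into (down (target f)) (pullback f) m"
  note F = principal_iso_graph[OF f] and G = principal_iso_graph[OF g]
  note cl = principal_isoD(1,2)[OF F] principal_isoD(1,2)[OF G]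
  have m: "m \<in> carrier L" "m \<sqsubseteq> source f" "m \<sqsubseteq> target g" using cl by (auto simp: m_def)
  have bf: "bij_betw (pullback f) (down (target f)) (down (source f))" using f unfolding phomeos_iff by simp
  have w: "w \<in> down (target f)" "pullback f w = m"
    using m bf unfolding w_def
    by (auto simp: bij_betw_def intro!: inv_into_into f_inv_into_f simp del: down_iff) (simp_all)
  have wm: "(m, w) \<in> phomeo_graph L f" using w by (simp add: mem_phomeo_graph)
  have mg: "(pullback g m, m) \<in> phomeo_graph L g" using m by (simp add: mem_phomeo_graph)
  define h where "h = phomeo_comp L f g"
  have h: "h = \<lparr>source = pullback g m, target = w, pullback = compose (down w) (pullback g) (pullback f)\<rparr>"
    unfolding h_def phomeo_comp_def Let_def m_def w_def by simp
  have hg: "(x, z) \<in> phomeo_graph L h \<longleftrightarrow> (x, z) \<in> phomeo_graph L g O phomeo_graph L f" for x z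
  proof
    assume "(x, z) \<in> phomeo_graph L h"
    then have z: "z \<in> carrier L" "z \<sqsubseteq> w" and x: "x = pullback g (pullback f z)"
      by (auto simp: mem_phomeo_graph h compose_def)
    have zf: "(pullback f z, z) \<in> phomeo_graph L f"
      using z w le_trans[of z w "target f"] cl by (simp add: mem_phomeo_graph)
    have "pullback f z \<sqsubseteq> m" using principal_isoD(7)[OF F zf wm] z by simp
    then have "(x, pullback f z) \<in> phomeo_graph L g"
      using x principal_isoD(3)[OF F zf] m cl le_trans[of "pullback f z" m "target g"] by (simp add: mem_phomeo_graph)
    then show "(x, z) \<in> phomeo_graph L g O phomeo_graph L f" using zf by blast
  next
    assume "(x, z) \<in> phomeo_graph L g O phomeo_graph L f"
    then obtain y where xy: "(x, y) \<in> phomeo_graph L g" and yz: "(y, z) \<in> phomeo_graph L f" by auto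
    have "y \<sqsubseteq> m"
      unfolding m_def using principal_isoD[OF F] principal_isoD[OF G] xy yz cl by (intro meet_le) auto
    then have "z \<sqsubseteq> w" using principal_isoD(7)[OF F yz wm] by simp
    then show "(x, z) \<in> phomeo_graph L h"
      using xy yz by (simp add: mem_phomeo_graph h compose_def)
  qed
  then show graph: "phomeo_graph L (phomeo_comp L f g) = phomeo_graph L g O phomeo_graph L f"
    unfolding h_def by auto
  show "(source (phomeo_comp L f g), source f \<sqinter> target g) \<in> phomeo_graph L g"
    using mg unfolding h_def[symmetric] m_def[symmetric] h by simp
  have "principal_iso (pullback g m) w (phomeo_graph L h)"
    unfolding principal_iso_def
  proof (intro conjI ballI allI impI subrelI)
    show "pullback g m \<in> carrier L" using principal_isoD(3)[OF G mg] .
    show "w \<in> carrier L" using w by simp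
    fix x z assume xz: "(x, z) \<in> phomeo_graph L h"
    then obtain y where xy: "(x, y) \<in> phomeo_graph L g" and yz: "(y, z) \<in> phomeo_graph L f"
      using hg by auto
    have z: "z \<in> down w" using xz by (simp add: mem_phomeo_graph h)
    then have "y \<sqsubseteq> m" using principal_isoD(7)[OF F yz wm] by simp
    then have "x \<sqsubseteq> pullback g m" using principal_isoD(7)[OF G xy mg] by simp
    then show "(x, z) \<in> down (pullback g m) \<times> down w"
      using z principal_isoD(3)[OF G xy] by simp
  next
    fix z assume "z \<in> down w"
    then show "\<exists>x. (x, z) \<in> phomeo_graph L h" by (simp add: mem_phomeo_graph h)
  next
    fix x assume "x \<in> down (pullback g m)"
    then have "x \<in> carrier L" "x \<sqsubseteq> pullback g m" by auto
    from principal_iso_image_below[OF G mg this]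
    obtain y where y: "(x, y) \<in> phomeo_graph L g" "y \<sqsubseteq> m" by auto
    from principal_iso_image_below[OF F wm principal_isoD(4)[OF G y(1)] y(2)]
    obtain z where "(y, z) \<in> phomeo_graph L f" by auto
    then show "\<exists>z. (x, z) \<in> phomeo_graph L h" using y hg by blast
  next
    fix x z x' z' assume xz: "(x, z) \<in> phomeo_graph L h" "(x', z') \<in> phomeo_graph L h"
    then obtain y y' where "(x, y) \<in> phomeo_graph L g" "(y, z) \<in> phomeo_graph L f"
      "(x', y') \<in> phomeo_graph L g" "(y', z') \<in> phomeo_graph L f"
      using hg by blast
    then show "x \<sqsubseteq> x' \<longleftrightarrow> z \<sqsubseteq> z'" using principal_isoD(7)[OF F] principal_isoD(7)[OF G] by metis
  qed
  note H = this
  \<comment> \<open>Membership of \<open>h\<close> is obtained indirectly: \<open>k\<close> is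
    realized from the same graph, and since both pullbacks are extensional on \<open>down w\<close>,
    the two records coincide.\<close>
  obtain k where k: "k \<in> phomeos L" "source k = pullback g m" "target k = w" "phomeo_graph L k = phomeo_graph L h"
    using phomeo_of_principal_iso[OF H] by auto
  have "pullback k = pullback h"
  proof (rule extensionalityI)
    show "pullback k \<in> extensional (down w)" using k unfolding phomeos_iff by auto
    show "pullback h \<in> extensional (down w)" by (simp add: h)
    fix y assume "y \<in> down w"
    then have "(pullback k y, y) \<in> phomeo_graph L k" using k(3) by (simp add: mem_phomeo_graph)
    then show "pullback k y = pullback h y" unfolding k(4) mem_phomeo_graph by (simp add: h)
  qed
  then have "k = h" using k(2,3) by (intro phomeo.equality) (auto simp: h)
  then show "phomeo_comp L f g \<in> phomeos L" using k(1) unfolding h_def by simp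
qed

lemma partial_homeos_simps [simp]:
  "carrier (partial_homeos L) = phomeos L"
  "f \<odot>\<^bsub>partial_homeos L\<^esub> g = phomeo_comp L f g"
  by (simp_all add: partial_homeos_def)

text \<open>Following a pair through the triple composites and using single-valuedness both ways
  forces the middle pair to be its converse. Uniqueness of inverses then follows from injectivity of
  graphs.\<close>

lemma is_inverse_partial_homeos_iff:
  assumes f: "f \<in> phomeos L" and g: "g \<in> phomeos L"
  shows "is_inverse (partial_homeos L) f g \<longleftrightarrow> phomeo_graph L g = (phomeo_graph L f)\<inverse>"
proof -
  let ?F = "phomeo_graph L f" and ?G = "phomeo_graph L g"
  note F = principal_iso_graph[OF f] and G = principal_iso_graph[OF g]
  have "is_inverse (partial_homeos L) f g \<longleftrightarrow> ?F O ?G O ?F = ?F \<and> ?G O ?F O ?G = ?G"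
    unfolding is_inverse_def using f g phomeo_comp_graph phomeo_graph_inj by (metis partial_homeos_simps(2))
  also have "\<dots> \<longleftrightarrow> ?G = ?F\<inverse>"
  proof
    assume "?F O ?G O ?F = ?F \<and> ?G O ?F O ?G = ?G"
    then have 1: "?F O ?G O ?F = ?F" and 2: "?G O ?F O ?G = ?G" by auto
    have "(y, x) \<in> ?F" if xy: "(x, y) \<in> ?G" for x y
    proof -
      have "(x, y) \<in> ?G O ?F O ?G" using xy 2 by simp
      then obtain a b where "(x, a) \<in> ?G" "(a, b) \<in> ?F" "(b, y) \<in> ?G" by auto
      then show ?thesis using principal_iso_functional[OF G xy] principal_iso_injective[OF G xy] by blast
    qed
    moreover have "(x, y) \<in> ?G" if xy: "(y, x) \<in> ?F" for x y
    proof -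
      have "(y, x) \<in> ?F O ?G O ?F" using xy 1 by simp
      then obtain a b where "(y, a) \<in> ?F" "(a, b) \<in> ?G" "(b, x) \<in> ?F" by auto
      then show ?thesis using principal_iso_functional[OF F xy] principal_iso_injective[OF F xy] by blast
    qed
    ultimately show "?G = ?F\<inverse>" by auto
  next
    assume "?G = ?F\<inverse>"
    then show "?F O ?G O ?F = ?F \<and> ?G O ?F O ?G = ?G"
      using principal_iso_functional[OF F] principal_iso_injective[OF F] by auto
  qed
  finally show ?thesis .
qed

lemma inverse_semigroup_partial_homeos: "inverse_semigroup (partial_homeos L)"
proof
  fix f g h assume fgh: "f \<in> carrier (partial_homeos L)" "g \<in> carrier (partial_homeos L)" "h \<in> carrier (partial_homeos L)"
  show "f \<odot>\<^bsub>partial_homeos L\<^esub> g \<in> carrier (partial_homeos L)" using fgh phomeo_comp_graph by simp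
  show "f \<odot>\<^bsub>partial_homeos L\<^esub> g \<odot>\<^bsub>partial_homeos L\<^esub> h = f \<odot>\<^bsub>partial_homeos L\<^esub> (g \<odot>\<^bsub>partial_homeos L\<^esub> h)"
    using fgh phomeo_comp_graph(1,2) by (simp add: phomeo_graph_inj O_assoc)
next
  fix f assume "f \<in> carrier (partial_homeos L)"
  then have f: "f \<in> phomeos L" by simp
  obtain g where g: "g \<in> phomeos L" "phomeo_graph L g = (phomeo_graph L f)\<inverse>"
    using phomeo_of_principal_iso[OF principal_iso_converse[OF principal_iso_graph[OF f]]] by auto
  show "\<exists>!g. g \<in> carrier (partial_homeos L) \<and> is_inverse (partial_homeos L) f g"
    using f g is_inverse_partial_homeos_iff[OF f] phomeo_graph_inj by (intro ex1I[where a = g]) auto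
qed

sublocale PH: inverse_semigroup "partial_homeos L"
  by (rule inverse_semigroup_partial_homeos)

lemma graph_sinv:
  assumes "f \<in> phomeos L"
  shows "phomeo_graph L (sinv (partial_homeos L) f) = (phomeo_graph L f)\<inverse>"
proof -
  have "is_inverse (partial_homeos L) f (sinv (partial_homeos L) f)"
    unfolding is_inverse_def using PH.mul_sinv_mul[of f] PH.sinv_mul_sinv[of f] assms by simp
  then show ?thesis using is_inverse_partial_homeos_iff assms PH.sinv_closed[of f] by simp
qed

text \<open>If \<open>(x, y)\<close> factors as \<open>(x, z)\<close> and \<open>(z, y)\<close>
  within one isomorphism, then \<open>y = z\<close> and \<open>x = z\<close>; idempotents are
  therefore partial identities.\<close>

lemma graph_idempotent_iff:
  assumes f: "f \<in> phomeos L"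
  shows "f \<in> idempotents (partial_homeos L) \<longleftrightarrow> phomeo_graph L f \<subseteq> Id"
proof -
  let ?F = "phomeo_graph L f"
  note F = principal_iso_graph[OF f]
  have "f \<in> idempotents (partial_homeos L) \<longleftrightarrow> ?F O ?F = ?F"
    unfolding idempotents_def using f phomeo_comp_graph[OF f f] phomeo_graph_inj[of "phomeo_comp L f f" f] by auto
  also have "\<dots> \<longleftrightarrow> ?F \<subseteq> Id"
  proof
    assume FF: "?F O ?F = ?F"
    show "?F \<subseteq> Id"
    proof (rule subrelI)
      fix x y assume xy: "(x, y) \<in> ?F"
      then have "(x, y) \<in> ?F O ?F" using FF by simp
      then obtain z where "(x, z) \<in> ?F" "(z, y) \<in> ?F" by auto
      then show "(x, y) \<in> Id" using principal_iso_functional[OF F xy] principal_iso_injective[OF F xy] by blast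
    qed
  qed auto
  finally show ?thesis .
qed

text \<open>For a restriction \<open>f\<close> of \<open>g\<close>, the witnessing idempotent is the
  inverse of \<open>f\<close> composed with \<open>f\<close>, the identity on the source of
  \<open>f\<close>.\<close>

lemma graph_subset_iff:
  assumes f: "f \<in> phomeos L" and g: "g \<in> phomeos L"
  shows "f \<sqsubseteq>\<^bsub>natural_order (partial_homeos L)\<^esub> g \<longleftrightarrow> phomeo_graph L f \<subseteq> phomeo_graph L g"
proof
  assume "f \<sqsubseteq>\<^bsub>natural_order (partial_homeos L)\<^esub> g"
  then obtain e where e: "e \<in> idempotents (partial_homeos L)" "f = phomeo_comp L g e"
    unfolding PH.nat_le_iff by auto
  then have "e \<in> phomeos L" by (auto simp: idempotents_def)
  then show "phomeo_graph L f \<subseteq> phomeo_graph L g"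
    using e graph_idempotent_iff[of e] phomeo_comp_graph[OF g, of e] by auto
next
  let ?i = "sinv (partial_homeos L) f"
  assume sub: "phomeo_graph L f \<subseteq> phomeo_graph L g"
  note F = principal_iso_graph[OF f] and G = principal_iso_graph[OF g]
  have i: "?i \<in> phomeos L" using PH.sinv_closed[of f] f by simp
  have e: "phomeo_comp L ?i f \<in> idempotents (partial_homeos L)" using PH.sinv_mul_idem(1)[of f] f by simp
  have "phomeo_graph L (phomeo_comp L g (phomeo_comp L ?i f)) = (phomeo_graph L f O (phomeo_graph L f)\<inverse>) O phomeo_graph L g"
    using i f g phomeo_comp_graph graph_sinv by simp
  also have "\<dots> = phomeo_graph L f"
  proof (intro subset_antisym subrelI)
    fix x z assume "(x, z) \<in> (phomeo_graph L f O (phomeo_graph L f)\<inverse>) O phomeo_graph L g"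
    then obtain y w where "(x, y) \<in> phomeo_graph L f" "(w, y) \<in> phomeo_graph L f" "(w, z) \<in> phomeo_graph L g"
      by auto
    then show "(x, z) \<in> phomeo_graph L f"
      using principal_iso_injective[OF F, of x y w] principal_iso_functional[OF G, of w y z] sub by auto
  qed (use sub in auto)
  finally have "f = phomeo_comp L g (phomeo_comp L ?i f)"
    using i f g phomeo_comp_graph by (intro phomeo_graph_inj) auto
  then show "f \<sqsubseteq>\<^bsub>natural_order (partial_homeos L)\<^esub> g" unfolding PH.nat_le_iff using e by auto
qed

text \<open>Idempotency of \<open>f\<close> times the inverse of \<open>g\<close> is agreement on
  common sources; idempotency of the other product is agreement on common targets.\<close>

lemma compatible_family_graphs:
  assumes "jointly_compatible (partial_homeos L) S"
  shows "compatible_family S source target (phomeo_graph L)"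
  unfolding compatible_family_def
proof (intro conjI ballI allI impI)
  have S: "f \<in> phomeos L" if "f \<in> S" for f using assms that by (auto simp: jointly_compatible_def)
  show "principal_iso (source f) (target f) (phomeo_graph L f)" if "f \<in> S" for f
    using S[OF that] by (rule principal_iso_graph)
  fix f g assume fg: "f \<in> S" "g \<in> S"
  let ?f = "sinv (partial_homeos L) f" and ?g = "sinv (partial_homeos L) g"
  have c: "f \<in> phomeos L" "g \<in> phomeos L" "?f \<in> phomeos L" "?g \<in> phomeos L"
    using S fg PH.sinv_closed[of f] PH.sinv_closed[of g] by auto
  have "phomeo_comp L f ?g \<in> idempotents (partial_homeos L)" "phomeo_comp L ?f g \<in> idempotents (partial_homeos L)"
    using assms fg by (auto simp: jointly_compatible_def)
  then have *: "(phomeo_graph L g)\<inverse> O phomeo_graph L f \<subseteq> Id" "phomeo_graph L g O (phomeo_graph L f)\<inverse> \<subseteq> Id"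
    using c graph_idempotent_iff phomeo_comp_graph graph_sinv by auto
  show "y = y'" if "(x, y) \<in> phomeo_graph L f" "(x, y') \<in> phomeo_graph L g" for x y y'
    using that * by blast
  show "x = x'" if "(x, y) \<in> phomeo_graph L f" "(x', y) \<in> phomeo_graph L g" for x x' y
    using that * by blast
qed

lemma phomeos_join:
  assumes S: "jointly_compatible (partial_homeos L) S"
  obtains F where "F \<in> phomeos L" "source F = \<Squnion>(source ` S)" "target F = \<Squnion>(target ` S)"
    "\<And>f. f \<in> S \<Longrightarrow> phomeo_graph L f \<subseteq> phomeo_graph L F"
proof -
  note fam = compatible_family_graphs[OF S]
  show thesis
    using that phomeo_of_principal_iso[OF principal_iso_glue[OF fam]] subset_glue[OF fam] by metis
qed

text \<open>The source inequality provides the cover for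
  \<open>principal_iso_subset_of_cover\<close>. All joins of partial homeomorphisms below are
  computed by this criterion.\<close>

lemma phomeos_join_eqI:
  assumes F: "F \<in> phomeos L" and S: "S \<subseteq> phomeos L" and le: "\<And>f. f \<in> S \<Longrightarrow> phomeo_graph L f \<subseteq> phomeo_graph L F"
    and src: "source F \<sqsubseteq> \<Squnion>(source ` S)"
  shows "least (natural_order (partial_homeos L)) F (Upper (natural_order (partial_homeos L)) S)"
    and "\<Squnion>\<^bsub>natural_order (partial_homeos L)\<^esub> S = F"
proof -
  have 1: "f \<sqsubseteq>\<^bsub>natural_order (partial_homeos L)\<^esub> F" if "f \<in> S" for f
    using that S F le graph_subset_iff by auto
  have 2: "F \<sqsubseteq>\<^bsub>natural_order (partial_homeos L)\<^esub> G"
    if G: "G \<in> phomeos L" and "\<And>f. f \<in> S \<Longrightarrow> f \<sqsubseteq>\<^bsub>natural_order (partial_homeos L)\<^esub> G" for G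
  proof -
    have "phomeo_graph L F \<subseteq> phomeo_graph L G"
    proof (rule principal_iso_subset_of_cover[OF principal_iso_graph[OF F] principal_iso_graph[OF G] _ _ _ src])
      fix f assume "f \<in> S"
      then show "principal_iso (source f) (target f) (phomeo_graph L f)" "phomeo_graph L f \<subseteq> phomeo_graph L F"
        "phomeo_graph L f \<subseteq> phomeo_graph L G"
        using S le that graph_subset_iff principal_iso_graph by blast+
    qed
    then show ?thesis using F G graph_subset_iff by simp
  qed
  show "least (natural_order (partial_homeos L)) F (Upper (natural_order (partial_homeos L)) S)"
    using F S 1 by (intro least_UpperI) (auto simp: Upper_def intro!: 2)
  show "\<Squnion>\<^bsub>natural_order (partial_homeos L)\<^esub> S = F"
    using F S 1 2 by (intro PH.join_eqI) auto
qed

theorem pseudogroup_partial_homeos: "pseudogroup (partial_homeos L)"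
proof
  fix S assume S: "jointly_compatible (partial_homeos L) S"
  then have Sc: "S \<subseteq> phomeos L" by (simp add: jointly_compatible_def)
  obtain F where F: "F \<in> phomeos L" "source F = \<Squnion>(source ` S)" "target F = \<Squnion>(target ` S)"
    and le: "\<And>f. f \<in> S \<Longrightarrow> phomeo_graph L f \<subseteq> phomeo_graph L F"
    using phomeos_join[OF S] by metis
  have FS: "source F \<sqsubseteq> \<Squnion>(source ` S)" using F(2) principal_isoD(1)[OF principal_iso_graph[OF F(1)]] by auto
  note join = phomeos_join_eqI[OF F(1) Sc le FS]
  have sc: "source f \<in> carrier L" "target f \<in> carrier L" if "f \<in> phomeos L" for f
    using that by (auto simp: phomeos_iff)
  have c: "source ` S \<subseteq> carrier L" "target ` S \<subseteq> carrier L" using Sc sc by auto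
  show "\<exists>s. least (natural_order (partial_homeos L)) s (Upper (natural_order (partial_homeos L)) S)"
    using join(1) by blast
  fix g assume "g \<in> carrier (partial_homeos L)"
  then have g: "g \<in> phomeos L" by simp
  have "\<Squnion>\<^bsub>natural_order (partial_homeos L)\<^esub> ((\<lambda>f. phomeo_comp L g f) ` S) = phomeo_comp L g F"
  proof (rule phomeos_join_eqI(2))
    show "phomeo_comp L g F \<in> phomeos L" "(\<lambda>f. phomeo_comp L g f) ` S \<subseteq> phomeos L"
      using phomeo_comp_graph(1)[OF g] F(1) Sc by auto
    show "phomeo_graph L h \<subseteq> phomeo_graph L (phomeo_comp L g F)" if h: "h \<in> (\<lambda>f. phomeo_comp L g f) ` S" for h
    proof -
      obtain f where "f \<in> S" "h = phomeo_comp L g f" using h by auto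
      then show ?thesis
        using phomeo_comp_graph(2)[OF g] F(1) subsetD[OF Sc, of f] relcomp_mono[OF le[of f] subset_refl] by simp
    qed
    \<comment> \<open>Joining these pairs inside the graph of \<open>F\<close> matches the joined
      sources with the join of the meeting opens. Distributivity turns the latter into
      \<open>source g \<sqinter> target F\<close>, whose partner is the source of the composite of
      \<open>g\<close> with \<open>F\<close>.\<close>
    define T where "T = (\<lambda>f. (source (phomeo_comp L g f), source g \<sqinter> target f)) ` S"
    have "T \<subseteq> phomeo_graph L F" using phomeo_comp_graph(3)[OF g] Sc le by (fastforce simp: T_def)
    from principal_iso_sup[OF principal_iso_graph[OF F(1)] this]
    have "(\<Squnion>(source ` (\<lambda>f. phomeo_comp L g f) ` S), \<Squnion>((\<lambda>b. source g \<sqinter> b) ` target ` S)) \<in> phomeo_graph L F"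
      by (simp add: T_def image_image)
    then have 1: "(\<Squnion>(source ` (\<lambda>f. phomeo_comp L g f) ` S), source g \<sqinter> target F) \<in> phomeo_graph L F"
      using meet_Sup_distrib[OF sc(1)[OF g] c(2)] F(3) by simp
    show "source (phomeo_comp L g F) \<sqsubseteq> \<Squnion>(source ` (\<lambda>f. phomeo_comp L g f) ` S)"
      using principal_iso_injective[OF principal_iso_graph[OF F(1)] 1 phomeo_comp_graph(3)[OF g F(1)]]
        principal_isoD(3)[OF principal_iso_graph[OF F(1)] 1] by simp
  qed
  then show "g \<odot>\<^bsub>partial_homeos L\<^esub> \<Squnion>\<^bsub>natural_order (partial_homeos L)\<^esub> S =
      \<Squnion>\<^bsub>natural_order (partial_homeos L)\<^esub> ((\<lambda>f. g \<odot>\<^bsub>partial_homeos L\<^esub> f) ` S)"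
    using join(2) by simp
  have "\<Squnion>\<^bsub>natural_order (partial_homeos L)\<^esub> ((\<lambda>f. phomeo_comp L f g) ` S) = phomeo_comp L F g"
  proof (rule phomeos_join_eqI(2))
    show "phomeo_comp L F g \<in> phomeos L" "(\<lambda>f. phomeo_comp L f g) ` S \<subseteq> phomeos L"
      using phomeo_comp_graph(1)[OF _ g] F(1) Sc by auto
    show "phomeo_graph L h \<subseteq> phomeo_graph L (phomeo_comp L F g)" if h: "h \<in> (\<lambda>f. phomeo_comp L f g) ` S" for h
    proof -
      obtain f where "f \<in> S" "h = phomeo_comp L f g" using h by auto
      then show ?thesis
        using phomeo_comp_graph(2)[OF _ g] F(1) subsetD[OF Sc, of f] relcomp_mono[OF subset_refl le[of f]] by simp
    qed
    \<comment> \<open>On this side the fixed \<open>g\<close> is applied first, so all pairs lie in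
      its graph and distributivity acts on the joined sources.\<close>
    define T where "T = (\<lambda>f. (source (phomeo_comp L f g), source f \<sqinter> target g)) ` S"
    have "T \<subseteq> phomeo_graph L g" using phomeo_comp_graph(3)[OF _ g] Sc by (auto simp: T_def)
    from principal_iso_sup[OF principal_iso_graph[OF g] this]
    have "(\<Squnion>(source ` (\<lambda>f. phomeo_comp L f g) ` S), \<Squnion>((\<lambda>b. b \<sqinter> target g) ` source ` S)) \<in> phomeo_graph L g"
      by (simp add: T_def image_image)
    then have 1: "(\<Squnion>(source ` (\<lambda>f. phomeo_comp L f g) ` S), source F \<sqinter> target g) \<in> phomeo_graph L g"
      using meet_Sup_distrib[OF sc(2)[OF g] c(1)] F(2) by (simp add: meet_comm)
    show "source (phomeo_comp L F g) \<sqsubseteq> \<Squnion>(source ` (\<lambda>f. phomeo_comp L f g) ` S)"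
      using principal_iso_injective[OF principal_iso_graph[OF g] 1 phomeo_comp_graph(3)[OF F(1) g]]
        principal_isoD(3)[OF principal_iso_graph[OF g] 1] by simp
  qed
  then show "\<Squnion>\<^bsub>natural_order (partial_homeos L)\<^esub> S \<odot>\<^bsub>partial_homeos L\<^esub> g =
      \<Squnion>\<^bsub>natural_order (partial_homeos L)\<^esub> ((\<lambda>f. f \<odot>\<^bsub>partial_homeos L\<^esub> g) ` S)"
    using join(2) by simp
qed

end

section \<open>The regular representation on the locale of ideals\<close>

context pseudogroup
begin

text \<open>The case \<open>S = {}\<close> is included, so every join ideal contains the zero of
  \<open>A\<close>.\<close>

definition join_ideal :: "'a set \<Rightarrow> bool" where
  "join_ideal U \<longleftrightarrow> U \<subseteq> carrier A \<and> (\<forall>x\<in>U. \<forall>y\<in>carrier A. y \<preceq> x \<longrightarrow> y \<in> U) \<and>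
    (\<forall>S\<subseteq>U. jointly_compatible A S \<longrightarrow> \<Or>S \<in> U)"

definition ideals :: "'a set gorder" where
  "ideals = \<lparr>carrier = {U. join_ideal U}, eq = (=), le = (\<subseteq>)\<rparr>"

lemma ideals_simps [simp]:
  "carrier ideals = {U. join_ideal U}" "eq ideals = (=)" "le ideals = (\<subseteq>)"
  by (simp_all add: ideals_def)

lemma join_idealI:
  assumes "U \<subseteq> carrier A" "\<And>x y. \<lbrakk>x \<in> U; y \<in> carrier A; y \<preceq> x\<rbrakk> \<Longrightarrow> y \<in> U"
    and "\<And>S. \<lbrakk>S \<subseteq> U; jointly_compatible A S\<rbrakk> \<Longrightarrow> \<Or>S \<in> U"
  shows "join_ideal U"
  using assms unfolding join_ideal_def by blast

lemma join_idealD: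
  assumes "join_ideal U"
  shows "U \<subseteq> carrier A" "\<lbrakk>x \<in> U; y \<preceq> x; y \<in> carrier A\<rbrakk> \<Longrightarrow> y \<in> U"
    and "\<lbrakk>S \<subseteq> U; jointly_compatible A S\<rbrakk> \<Longrightarrow> \<Or>S \<in> U"
  using assms unfolding join_ideal_def by blast+

text \<open>Meeting with \<open>carrier A\<close> gives the empty family the right intersection, the
  top ideal.\<close>

lemma join_ideal_Inter:
  assumes "\<And>U. U \<in> \<U> \<Longrightarrow> join_ideal U"
  shows "join_ideal (carrier A \<inter> \<Inter>\<U>)"
proof (rule join_idealI)
  show "carrier A \<inter> \<Inter>\<U> \<subseteq> carrier A" by simp
  show "y \<in> carrier A \<inter> \<Inter>\<U>" if "x \<in> carrier A \<inter> \<Inter>\<U>" "y \<in> carrier A" "y \<preceq> x" for x y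
    using that join_idealD(2)[OF assms] by blast
  show "\<Or>S \<in> carrier A \<inter> \<Inter>\<U>" if "S \<subseteq> carrier A \<inter> \<Inter>\<U>" "jointly_compatible A S" for S
    using that join_idealD(3)[OF assms] join_closed by (simp add: le_Inf_iff)
qed

lemma join_ideal_Int:
  assumes "join_ideal U" "join_ideal V"
  shows "join_ideal (U \<inter> V)"
proof -
  have "carrier A \<inter> \<Inter>{U, V} = U \<inter> V" using join_idealD(1)[OF assms(1)] by auto
  then show ?thesis using join_ideal_Inter[of "{U, V}"] assms by auto
qed

definition below where "below x = {y \<in> carrier A. y \<preceq> x}"

lemma join_ideal_below: "x \<in> carrier A \<Longrightarrow> join_ideal (below x)"
  unfolding below_def
  by (intro join_idealI) (auto intro: nat_le_trans join_least)

definition generated where "generated X = carrier A \<inter> \<Inter>{U. join_ideal U \<and> X \<subseteq> U}"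

lemma join_ideal_generated: "join_ideal (generated X)"
  unfolding generated_def by (rule join_ideal_Inter) auto

lemma generated_least: "join_ideal U \<Longrightarrow> X \<subseteq> U \<Longrightarrow> generated X \<subseteq> U"
  unfolding generated_def by auto

lemma generated_upper: "X \<subseteq> carrier A \<Longrightarrow> X \<subseteq> generated X"
  unfolding generated_def by auto

lemma partial_order_ideals: "partial_order ideals"
  by unfold_locales auto

interpretation I: partial_order ideals by (rule partial_order_ideals)

lemma Union_ideals_closed: "\<B> \<subseteq> carrier ideals \<Longrightarrow> \<Union>\<B> \<subseteq> carrier A"
  by (rule Union_least, rule join_idealD(1)) auto

lemma sup_ideals:
  assumes "\<B> \<subseteq> carrier ideals"
  shows "\<Squnion>\<^bsub>ideals\<^esub> \<B> = generated (\<Union>\<B>)"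
proof (rule I.sup_eqI)
  show "s \<sqsubseteq>\<^bsub>ideals\<^esub> generated (\<Union>\<B>)" if "s \<in> \<B>" for s
    using generated_upper[OF Union_ideals_closed[OF assms]] that by auto
  show "generated (\<Union>\<B>) \<sqsubseteq>\<^bsub>ideals\<^esub> c"
    if "c \<in> carrier ideals" "\<And>s. s \<in> \<B> \<Longrightarrow> s \<sqsubseteq>\<^bsub>ideals\<^esub> c" for c
    using that by (simp add: Sup_least generated_least)
qed (use assms join_ideal_generated in auto)

lemma meet_ideals:
  assumes "join_ideal U" "join_ideal V"
  shows "U \<sqinter>\<^bsub>ideals\<^esub> V = U \<inter> V"
  using assms join_ideal_Int by (intro I.meet_eqI) auto

text \<open>For distributivity, \<open>W\<close> is the Heyting implication from \<open>U\<close> to the right-hand side.\<close>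

lemma ideal_distrib:
  assumes U: "join_ideal U" and B: "\<B> \<subseteq> carrier ideals"
  shows "U \<inter> generated (\<Union>\<B>) \<subseteq> generated (\<Union>((\<lambda>V. U \<inter> V) ` \<B>))"
proof -
  define G where "G = generated (\<Union>((\<lambda>V. U \<inter> V) ` \<B>))"
  have G: "join_ideal G" unfolding G_def by (rule join_ideal_generated)
  define W where "W = {x \<in> carrier A. \<forall>y\<in>U. y \<preceq> x \<longrightarrow> y \<in> G}"
  note Uc = join_idealD(1)[OF U]
  have "join_ideal W"
  proof (rule join_idealI)
    show "W \<subseteq> carrier A" by (auto simp: W_def)
    show "y \<in> W" if "x \<in> W" "y \<in> carrier A" "y \<preceq> x" for x y
      using that nat_le_trans[of _ y x] by (auto simp: W_def)
    fix S assume S: "S \<subseteq> W" "jointly_compatible A S"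
    have "y \<in> G" if y: "y \<in> U" "y \<preceq> \<Or>S" for y
    proof -
      obtain e where e: "e \<in> idempotents A" "y = \<Or>S \<odot> e" using y(2) by (auto simp: nat_le_iff)
      have ec: "e \<in> carrier A" using e by auto
      \<comment> \<open>Distributivity of \<open>A\<close> enters here: \<open>y\<close> splits into
        pieces \<open>s \<odot> e\<close>, each below \<open>y\<close>, hence in \<open>U\<close>,
        and below a member of \<open>W\<close>, hence in \<open>G\<close>.\<close>
      have y': "y = \<Or>((\<lambda>s. s \<odot> e) ` S)" using e mul_join_right[OF ec S(2)] by simp
      have jc: "jointly_compatible A ((\<lambda>s. s \<odot> e) ` S)" using S(2) ec by (rule jointly_compatible_mul_right)
      have "(\<lambda>s. s \<odot> e) ` S \<subseteq> G"
      proof (rule image_subsetI)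
        fix s assume s: "s \<in> S"
        then have sc: "s \<in> carrier A" and sW: "s \<in> W" using S by (auto simp: W_def)
        have "s \<odot> e \<preceq> y" unfolding y' using s by (intro join_upper[OF jc]) auto
        then have "s \<odot> e \<in> U" using join_idealD(2)[OF U y(1)] sc ec by auto
        then show "s \<odot> e \<in> G" using sW sc e by (auto simp: W_def)
      qed
      then show ?thesis using join_idealD(3)[OF G _ jc] y' by simp
    qed
    then show "\<Or>S \<in> W" using S(2) by (auto simp: W_def)
  qed
  moreover have "\<Union>\<B> \<subseteq> W"
  proof
    fix x assume "x \<in> \<Union>\<B>"
    then obtain V where V: "V \<in> \<B>" "x \<in> V" "join_ideal V" using B by auto
    have "\<Union>((\<lambda>V. U \<inter> V) ` \<B>) \<subseteq> G" unfolding G_def using Uc by (intro generated_upper) auto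
    then have "U \<inter> V \<subseteq> G" using V(1) by auto
    moreover have "y \<in> V" if "y \<in> U" "y \<preceq> x" for y
      using that join_idealD(2)[OF V(3,2)] Uc by auto
    ultimately show "x \<in> W" using join_idealD(1)[OF V(3)] V(2) by (auto simp: W_def)
  qed
  ultimately have "generated (\<Union>\<B>) \<subseteq> W" by (rule generated_least)
  then show ?thesis unfolding G_def[symmetric] using Uc by (auto simp: W_def)
qed

theorem frame_ideals: "frame ideals"
proof
  fix \<B> assume B: "\<B> \<subseteq> carrier ideals"
  have "least ideals (generated (\<Union>\<B>)) (Upper ideals \<B>)"
  proof (rule least_UpperI)
    show "V \<sqsubseteq>\<^bsub>ideals\<^esub> generated (\<Union>\<B>)" if "V \<in> \<B>" for V
      using generated_upper[OF Union_ideals_closed[OF B]] that by auto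
    show "generated (\<Union>\<B>) \<sqsubseteq>\<^bsub>ideals\<^esub> V" if "V \<in> Upper ideals \<B>" for V
    proof -
      have "join_ideal V" "\<Union>\<B> \<subseteq> V" using that B unfolding Upper_def by auto
      then show ?thesis using generated_least by simp
    qed
  qed (use B join_ideal_generated in auto)
  then show "\<exists>s. least ideals s (Upper ideals \<B>)" by blast
  have "greatest ideals (carrier A \<inter> \<Inter>\<B>) (Lower ideals \<B>)"
  proof (rule greatest_LowerI)
    show "V \<sqsubseteq>\<^bsub>ideals\<^esub> carrier A \<inter> \<Inter>\<B>" if "V \<in> Lower ideals \<B>" for V
    proof -
      have "join_ideal V" "V \<subseteq> \<Inter>\<B>" using that B unfolding Lower_def by auto
      then show ?thesis using join_idealD(1) by simp
    qed
    show "carrier A \<inter> \<Inter>\<B> \<in> carrier ideals" using join_ideal_Inter[of \<B>] B by auto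
  qed (use B in auto)
  then show "\<exists>s. greatest ideals s (Lower ideals \<B>)" by blast
next
  fix U \<B> assume "U \<in> carrier ideals" and B: "\<B> \<subseteq> carrier ideals"
  then have U: "join_ideal U" by simp
  have im: "(\<lambda>V. U \<sqinter>\<^bsub>ideals\<^esub> V) ` \<B> = (\<lambda>V. U \<inter> V) ` \<B>"
    using B meet_ideals[OF U] by (intro image_cong) auto
  have UB: "(\<lambda>V. U \<inter> V) ` \<B> \<subseteq> carrier ideals" using B join_ideal_Int[OF U] by auto
  have "generated (\<Union>((\<lambda>V. U \<inter> V) ` \<B>)) \<subseteq> U \<inter> generated (\<Union>\<B>)"
    using generated_upper[OF Union_ideals_closed[OF B]]
    by (intro generated_least join_ideal_Int U join_ideal_generated) auto
  with ideal_distrib[OF U B]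
  show "U \<sqinter>\<^bsub>ideals\<^esub> \<Squnion>\<^bsub>ideals\<^esub> \<B> = \<Squnion>\<^bsub>ideals\<^esub> ((\<lambda>V. U \<sqinter>\<^bsub>ideals\<^esub> V) ` \<B>)"
    unfolding im sup_ideals[OF B] sup_ideals[OF UB] meet_ideals[OF U join_ideal_generated] by (rule subset_antisym)
qed

interpretation Y: frame ideals by (rule frame_ideals)

section \<open>The action by left translation\<close>

text \<open>Equivalently, \<open>x \<odot> \<iota> x \<preceq> \<iota> a \<odot> a\<close>.\<close>

definition domain_of where "domain_of a = {x \<in> carrier A. \<iota> a \<odot> (a \<odot> x) = x}"

text \<open>Left multiplication by \<open>\<iota> a \<odot> a\<close> commutes with right
  multiplication by idempotents and with compatible joins, so its fixed points are closed under both
  operations.\<close>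

lemma join_ideal_domain:
  assumes a: "a \<in> carrier A"
  shows "join_ideal (domain_of a)"
proof (rule join_idealI)
  show "domain_of a \<subseteq> carrier A" by (auto simp: domain_of_def)
  fix x y assume xy: "x \<in> domain_of a" "y \<preceq> x" "y \<in> carrier A"
  then obtain e where e: "e \<in> idempotents A" "y = x \<odot> e" by (auto simp: nat_le_iff)
  have x: "x \<in> carrier A" "\<iota> a \<odot> (a \<odot> x) = x" using xy by (auto simp: domain_of_def)
  have "\<iota> a \<odot> (a \<odot> y) = \<iota> a \<odot> (a \<odot> x) \<odot> e"
    unfolding e(2) using x(1) e(1) a by (simp add: mul_assoc idempotentsD)
  then show "y \<in> domain_of a" using x(2) xy e by (simp add: domain_of_def)
next
  fix S assume S: "S \<subseteq> domain_of a" "jointly_compatible A S"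
  have "\<iota> a \<odot> (a \<odot> \<Or>S) = \<Or>((\<lambda>s. \<iota> a \<odot> (a \<odot> s)) ` S)"
    using mul_join_left[OF a S(2)] mul_join_left[OF sinv_closed[OF a] jointly_compatible_mul_left[OF S(2) a]]
    by (simp add: image_image)
  also have "(\<lambda>s. \<iota> a \<odot> (a \<odot> s)) ` S = (\<lambda>s. s) ` S"
    by (rule image_cong[OF refl]) (use S(1) in \<open>auto simp: domain_of_def\<close>)
  finally show "\<Or>S \<in> domain_of a" using S(2) by (simp add: domain_of_def)
qed

definition translate where "translate a U = (\<lambda>x. a \<odot> x) ` U"

text \<open>An element below \<open>a \<odot> u\<close> is \<open>a \<odot> (u \<odot> e)\<close>
  with \<open>u \<odot> e\<close> below \<open>u\<close>. For joins, a compatible set is carried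
  back into \<open>U\<close> by \<open>\<iota> a\<close>, joined there, and carried forward
  again.\<close>

lemma translate_ideal:
  assumes a: "a \<in> carrier A" and U: "join_ideal U" "U \<subseteq> domain_of a"
  shows "join_ideal (translate a U)" "translate a U \<subseteq> domain_of (\<iota> a)"
    and "translate (\<iota> a) (translate a U) = U"
proof -
  note Uc = join_idealD(1)[OF U(1)]
  show sub: "translate a U \<subseteq> domain_of (\<iota> a)"
    unfolding translate_def
  proof (rule image_subsetI)
    fix x assume "x \<in> U"
    then have "x \<in> carrier A" using Uc by auto
    then show "a \<odot> x \<in> domain_of (\<iota> a)" using a by (simp add: domain_of_def sinv_cancel)
  qed
  show tt: "translate (\<iota> a) (translate a U) = U"
  proof -
    have "(\<lambda>x. \<iota> a \<odot> (a \<odot> x)) ` U = (\<lambda>x. x) ` U"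
      by (rule image_cong[OF refl]) (use U(2) in \<open>auto simp: domain_of_def\<close>)
    then show ?thesis by (simp add: translate_def image_image)
  qed
  show "join_ideal (translate a U)"
  proof (rule join_idealI)
    show "translate a U \<subseteq> carrier A" using a Uc by (auto simp: translate_def)
    show "y \<in> translate a U" if xy: "x \<in> translate a U" "y \<in> carrier A" "y \<preceq> x" for x y
    proof -
      obtain u e where u: "u \<in> U" "x = a \<odot> u" and e: "e \<in> idempotents A" "y = x \<odot> e"
        using xy by (auto simp: translate_def nat_le_iff)
      have uc: "u \<in> carrier A" "e \<in> carrier A" using u Uc e by auto
      then have "u \<odot> e \<in> U" using join_idealD(2)[OF U(1) u(1), of "u \<odot> e"] e by auto
      then show ?thesis using u e a uc by (auto simp: translate_def mul_assoc)
    qed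
    fix S assume S: "S \<subseteq> translate a U" "jointly_compatible A S"
    let ?T = "(\<lambda>s. \<iota> a \<odot> s) ` S"
    have T: "?T \<subseteq> U" using S(1) tt by (auto simp: translate_def)
    have jc: "jointly_compatible A ?T" using S(2) a by (intro jointly_compatible_mul_left) auto
    have "a \<odot> \<Or>?T = \<Or>((\<lambda>s. a \<odot> (\<iota> a \<odot> s)) ` S)"
      using mul_join_left[OF a jc] by (simp add: image_image)
    also have "(\<lambda>s. a \<odot> (\<iota> a \<odot> s)) ` S = (\<lambda>s. s) ` S"
      by (rule image_cong[OF refl]) (use subset_trans[OF S(1) sub] a in \<open>auto simp: domain_of_def\<close>)
    finally show "\<Or>S \<in> translate a U"
      using imageI[OF join_idealD(3)[OF U(1) T jc], of "\<lambda>x. a \<odot> x"] by (simp add: translate_def)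
  qed
qed

text \<open>The homeomorphism is translation by \<open>a\<close>; the record stores inverse images,
  so its pullback is translation by \<open>\<iota> a\<close>.\<close>

definition representation :: "'a \<Rightarrow> 'a set phomeo" where
  "representation a = \<lparr>source = domain_of a, target = domain_of (\<iota> a),
     pullback = restrict (translate (\<iota> a)) (carrier (open_sublocale ideals (domain_of (\<iota> a))))\<rparr>"

lemma representation_phomeo:
  assumes a: "a \<in> carrier A"
  shows "representation a \<in> phomeos ideals"
proof -
  have ia: "\<iota> a \<in> carrier A" and iia: "\<iota> (\<iota> a) = a" using a by auto
  note t = translate_ideal[OF a] translate_ideal[OF ia, unfolded iia]
  have mono: "translate c U \<subseteq> translate c V" if "U \<subseteq> V" for c U V
    using that by (auto simp: translate_def)
  show ?thesis
    unfolding Y.phomeos_iff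
  proof (intro conjI ballI)
    show "source (representation a) \<in> carrier ideals" "target (representation a) \<in> carrier ideals"
      using join_ideal_domain a ia by (auto simp: representation_def)
    show "pullback (representation a) \<in> extensional (Y.down (target (representation a)))"
      by (simp add: representation_def)
    show "bij_betw (pullback (representation a)) (Y.down (target (representation a))) (Y.down (source (representation a)))"
      using t by (intro bij_betw_byWitness[where f' = "translate a"]) (auto simp: representation_def)
    fix U V assume UV: "U \<in> Y.down (target (representation a))" "V \<in> Y.down (target (representation a))"
    have "U \<subseteq> V \<longleftrightarrow> translate (\<iota> a) U \<subseteq> translate (\<iota> a) V"
      using mono[of U V "\<iota> a"] mono[of "translate (\<iota> a) U" "translate (\<iota> a) V" a] UV t(6)[of U] t(6)[of V]
      by (auto simp: representation_def)
    then show "U \<sqsubseteq>\<^bsub>ideals\<^esub> V \<longleftrightarrow> pullback (representation a) U \<sqsubseteq>\<^bsub>ideals\<^esub> pullback (representation a) V"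
      using UV by (simp add: representation_def)
  qed
qed

lemma representation_graph:
  assumes a: "a \<in> carrier A"
  shows "(U, V) \<in> phomeo_graph ideals (representation a) \<longleftrightarrow>
    join_ideal U \<and> U \<subseteq> domain_of a \<and> V = translate a U"
proof -
  have ia: "\<iota> a \<in> carrier A" and iia: "\<iota> (\<iota> a) = a" using a by auto
  note t = translate_ideal[OF a] translate_ideal[OF ia, unfolded iia]
  show ?thesis
    unfolding Y.mem_phomeo_graph using t(1-3)[of U] t(4-6)[of V]
    by (auto simp: representation_def)
qed

lemma representation_mul:
  assumes a: "a \<in> carrier A" and b: "b \<in> carrier A"
  shows "representation (a \<odot> b) = phomeo_comp ideals (representation a) (representation b)"
proof (rule Y.phomeo_graph_inj)
  note c = representation_phomeo[OF a] representation_phomeo[OF b]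
  show "representation (a \<odot> b) \<in> phomeos ideals" using a b by (intro representation_phomeo) auto
  show "phomeo_comp ideals (representation a) (representation b) \<in> phomeos ideals"
    using c by (rule Y.phomeo_comp_graph)
  have dom: "x \<in> domain_of (a \<odot> b) \<longleftrightarrow> x \<in> domain_of b \<and> b \<odot> x \<in> domain_of a" if x: "x \<in> carrier A" for x
  proof
    assume "x \<in> domain_of (a \<odot> b)"
    then have 1: "\<iota> b \<odot> (\<iota> a \<odot> (a \<odot> (b \<odot> x))) = x"
      using a b x by (simp add: domain_of_def sinv_mul mul_assoc)
    have "\<iota> b \<odot> (b \<odot> x) = x"
      using sinv_cancel(2)[OF b, of "\<iota> a \<odot> (a \<odot> (b \<odot> x))"] a b x unfolding 1 by simp
    then have 2: "x \<in> domain_of b" using x by (simp add: domain_of_def)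
    \<comment> \<open>Inserting \<open>b \<odot> \<iota> b\<close> before \<open>b \<odot> x\<close>
      and commuting it past \<open>\<iota> a \<odot> a\<close> produces the left side of
      \<open>1\<close>, which collapses to \<open>x\<close>.\<close>
    have "\<iota> a \<odot> (a \<odot> (b \<odot> x)) = \<iota> a \<odot> a \<odot> (b \<odot> \<iota> b) \<odot> (b \<odot> x)"
      using a b x by (simp add: mul_assoc sinv_cancel)
    also have "\<dots> = b \<odot> \<iota> b \<odot> (\<iota> a \<odot> a) \<odot> (b \<odot> x)"
      using a b idempotents_commute[of "\<iota> a \<odot> a" "b \<odot> \<iota> b"] by simp
    also have "\<dots> = b \<odot> x" using a b x 1 by (simp add: mul_assoc)
    finally show "x \<in> domain_of b \<and> b \<odot> x \<in> domain_of a" using 2 b x by (simp add: domain_of_def)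
  next
    assume "x \<in> domain_of b \<and> b \<odot> x \<in> domain_of a"
    then show "x \<in> domain_of (a \<odot> b)" using a b x by (simp add: domain_of_def sinv_mul mul_assoc)
  qed
  have 1: "U \<subseteq> domain_of (a \<odot> b) \<longleftrightarrow> U \<subseteq> domain_of b \<and> translate b U \<subseteq> domain_of a" if "join_ideal U" for U
    using join_idealD(1)[OF that] dom by (auto simp: translate_def subset_iff)
  have 2: "translate (a \<odot> b) U = translate a (translate b U)" if "join_ideal U" for U
    using join_idealD(1)[OF that] a b unfolding translate_def image_image
    by (intro image_cong) (auto simp: mul_assoc)
  have "(U, V) \<in> phomeo_graph ideals (representation (a \<odot> b)) \<longleftrightarrow>
    (U, V) \<in> phomeo_graph ideals (representation b) O phomeo_graph ideals (representation a)" for U V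
    unfolding relcomp_unfold using a b 1[of U] 2[of U] translate_ideal(1)[OF b, of U] by (auto simp: representation_graph)
  then show "phomeo_graph ideals (representation (a \<odot> b)) =
      phomeo_graph ideals (phomeo_comp ideals (representation a) (representation b))"
    unfolding Y.phomeo_comp_graph(2)[OF c] by auto
qed

section \<open>Faithfulness and preservation of order, unit, joins and meets\<close>

lemma representation_mono:
  assumes "a \<preceq> b" "b \<in> carrier A"
  shows "representation a \<sqsubseteq>\<^bsub>natural_order (partial_homeos ideals)\<^esub> representation b"
proof -
  obtain e where e: "e \<in> idempotents A" "a = b \<odot> e" using assms by (auto simp: nat_le_iff)
  have ec: "e \<in> carrier A" using e by auto
  have "representation e \<in> idempotents (partial_homeos ideals)"
    unfolding idempotents_def
    using representation_mul[OF ec ec] idempotentsD(2)[OF e(1)] representation_phomeo[OF ec] by simp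
  then show ?thesis
    unfolding Y.PH.nat_le_iff using representation_mul[OF assms(2) ec] e by auto
qed

text \<open>The principal ideal of \<open>x\<close> is sent to that of \<open>a x\<close>, so its image determines \<open>a x\<close>.\<close>

lemma translate_below_eq:
  assumes "a \<in> carrier A" "b \<in> carrier A" "x \<in> carrier A" "translate a (below x) = translate b (below x)"
  shows "a \<odot> x = b \<odot> x"
proof -
  have le: "c \<odot> x \<preceq> d \<odot> x"
    if c: "c \<in> carrier A" and d: "d \<in> carrier A" and eq: "translate c (below x) = translate d (below x)" for c d
  proof -
    have "c \<odot> x \<in> translate c (below x)"
      unfolding translate_def using assms(3) by (intro imageI) (auto simp: below_def)
    with eq obtain y where "y \<preceq> x" "c \<odot> x = d \<odot> y" by (auto simp: translate_def below_def)
    then show ?thesis using nat_le_mul_left d assms(3) by simp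
  qed
  show ?thesis using le[of a b] le[of b a] assms by (intro nat_le_antisym) auto
qed

lemma representation_inj: "inj_on representation (carrier A)"
proof (rule inj_onI)
  have le: "a \<preceq> b" if a: "a \<in> carrier A" and b: "b \<in> carrier A" and eq: "representation a = representation b" for a b
  proof -
    \<comment> \<open>This test element lies in the domain of \<open>a\<close> and satisfies
      \<open>a \<odot> x = a\<close>, while \<open>b \<odot> x\<close> is a restriction of
      \<open>b\<close>; equality of the two gives \<open>a \<preceq> b\<close>.\<close>
    define x where "x = \<iota> a \<odot> a"
    have x: "x \<in> carrier A" "x \<in> domain_of a" using a by (auto simp: x_def domain_of_def mul_assoc sinv_cancel)
    have "below x \<subseteq> domain_of a"
      using join_idealD(2)[OF join_ideal_domain[OF a] x(2)] by (auto simp: below_def)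
    then have "(below x, translate a (below x)) \<in> phomeo_graph ideals (representation b)"
      using representation_graph[OF a] join_ideal_below[OF x(1)] eq by auto
    then have "translate a (below x) = translate b (below x)" using representation_graph[OF b] by simp
    then have "a \<odot> x = b \<odot> x" using a b x(1) by (intro translate_below_eq)
    moreover have "a \<odot> x = a" using a by (simp add: x_def sinv_cancel)
    ultimately show "a \<preceq> b" using a b by (simp add: x_def nat_le_iff) (metis sinv_mul_idem(1))
  qed
  fix a b assume "a \<in> carrier A" "b \<in> carrier A" "representation a = representation b"
  then show "a = b" using le[of a b] le[of b a] by (intro nat_le_antisym) auto
qed

text \<open>The image \<open>?r\<close> of the unit is the identity on every open, hence absorbed by
  \<open>?u\<close>; but \<open>?u\<close> is a unit, so the same product also equals
  \<open>?r\<close>. The join defining \<open>?u\<close> is thus never computed.\<close>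

lemma representation_unit: "representation (pg_unit A) = pg_unit (partial_homeos ideals)"
proof -
  interpret B: pseudogroup "partial_homeos ideals" by (rule Y.pseudogroup_partial_homeos)
  let ?u = "pg_unit (partial_homeos ideals)" and ?r = "representation (pg_unit A)"
  have u: "?u \<in> phomeos ideals" using B.pg_unit_closed by simp
  have r: "?r \<in> phomeos ideals" by (intro representation_phomeo) auto
  have "pg_unit A \<in> idempotents A" by (rule idempotentsI) auto
  then have "\<iota> (pg_unit A) = pg_unit A" by simp
  then have id: "(V, V) \<in> phomeo_graph ideals ?r" if "join_ideal V" for V
    using that join_idealD(1)[OF that]
    by (auto simp: representation_graph domain_of_def translate_def subset_iff)
  have "phomeo_comp ideals ?r ?u = ?u"
  proof (rule Y.phomeo_graph_inj)
    have "phomeo_graph ideals ?u O phomeo_graph ideals ?r = phomeo_graph ideals ?u"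
    proof (intro subset_antisym subrelI)
      fix U W assume "(U, W) \<in> phomeo_graph ideals ?u O phomeo_graph ideals ?r"
      then obtain V where V: "(U, V) \<in> phomeo_graph ideals ?u" "(V, W) \<in> phomeo_graph ideals ?r" by auto
      have "join_ideal V" using Y.principal_isoD(4)[OF Y.principal_iso_graph[OF u] V(1)] by simp
      then show "(U, W) \<in> phomeo_graph ideals ?u"
        using V Y.principal_iso_functional[OF Y.principal_iso_graph[OF r] V(2) id] by simp
    next
      fix U V assume V: "(U, V) \<in> phomeo_graph ideals ?u"
      have "join_ideal V" using Y.principal_isoD(4)[OF Y.principal_iso_graph[OF u] V] by simp
      then show "(U, V) \<in> phomeo_graph ideals ?u O phomeo_graph ideals ?r" using V id by blast
    qed
    then show "phomeo_graph ideals (phomeo_comp ideals ?r ?u) = phomeo_graph ideals ?u"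
      using Y.phomeo_comp_graph(2)[OF r u] by simp
  qed (use u r Y.phomeo_comp_graph(1) in auto)
  then show ?thesis using B.pg_unit_right[of ?r] r by simp
qed

text \<open>An \<open>x\<close> in the domain of the join is the compatible join of the elements
  \<open>\<iota> (\<Or>S) \<odot> (s \<odot> x)\<close>, and each equals
  \<open>\<iota> s \<odot> (s \<odot> x)\<close>, which lies in the domain of \<open>s\<close>.
  Closure of ideals under compatible joins then captures \<open>x\<close>.\<close>

lemma domain_of_join:
  assumes S: "jointly_compatible A S"
  shows "domain_of (\<Or>S) \<subseteq> \<Squnion>\<^bsub>ideals\<^esub> (domain_of ` S)"
proof
  fix x assume "x \<in> domain_of (\<Or>S)"
  then have x: "x \<in> carrier A" "\<iota> (\<Or>S) \<odot> (\<Or>S \<odot> x) = x" by (auto simp: domain_of_def)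
  have Sc: "S \<subseteq> carrier A" using S by (simp add: jointly_compatible_def)
  have F: "\<iota> (\<Or>S) \<in> carrier A" "\<Or>S \<in> carrier A" using S by auto
  have D: "domain_of ` S \<subseteq> carrier ideals" using join_ideal_domain Sc by auto
  note jc = jointly_compatible_mul_right[OF S x(1)]
  note jc' = jointly_compatible_mul_left[OF jc F(1)]
  have x': "x = \<Or>((\<lambda>s. \<iota> (\<Or>S) \<odot> s) ` (\<lambda>s. s \<odot> x) ` S)"
    using x mul_join_right[OF x(1) S] mul_join_left[OF F(1) jc] by simp
  have "(\<lambda>s. \<iota> (\<Or>S) \<odot> s) ` (\<lambda>s. s \<odot> x) ` S \<subseteq> generated (\<Union>(domain_of ` S))"
    unfolding image_image
  proof (rule image_subsetI)
    fix s assume s: "s \<in> S"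
    then have sc: "s \<in> carrier A" using Sc by auto
    have "\<iota> (\<Or>S) \<odot> (s \<odot> x) = \<iota> s \<odot> (s \<odot> x)"
      using nat_le_eq(2)[OF sc F(2) join_upper[OF S s]] sc F x by (metis mul_assoc sinv_closed)
    moreover have "\<iota> s \<odot> (s \<odot> x) \<in> domain_of s" using sc x by (simp add: domain_of_def sinv_cancel)
    ultimately show "\<iota> (\<Or>S) \<odot> (s \<odot> x) \<in> generated (\<Union>(domain_of ` S))"
      using generated_upper[OF Union_ideals_closed[OF D]] s by auto
  qed
  from join_idealD(3)[OF join_ideal_generated this jc']
  show "x \<in> \<Squnion>\<^bsub>ideals\<^esub> (domain_of ` S)" unfolding sup_ideals[OF D] using x' by simp
qed

lemma representation_join:
  assumes S: "jointly_compatible A S"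
  shows "representation (\<Or>S) = \<Squnion>\<^bsub>natural_order (partial_homeos ideals)\<^esub> (representation ` S)"
proof (rule Y.phomeos_join_eqI(2)[symmetric])
  have Sc: "S \<subseteq> carrier A" using S by (simp add: jointly_compatible_def)
  show c: "representation (\<Or>S) \<in> phomeos ideals" "representation ` S \<subseteq> phomeos ideals"
    using S Sc representation_phomeo by auto
  show "phomeo_graph ideals f \<subseteq> phomeo_graph ideals (representation (\<Or>S))" if "f \<in> representation ` S" for f
    using that S Sc c Y.graph_subset_iff[OF _ c(1)] representation_mono join_upper[OF S] by blast
  show "source (representation (\<Or>S)) \<sqsubseteq>\<^bsub>ideals\<^esub> \<Squnion>\<^bsub>ideals\<^esub> (source ` representation ` S)"
    using domain_of_join[OF S] by (simp add: representation_def image_image)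
qed

lemma representation_meet:
  assumes a: "a \<in> carrier A" and b: "b \<in> carrier A"
  shows "representation (a \<sqinter>\<^bsub>natural_order A\<^esub> b) =
    representation a \<sqinter>\<^bsub>natural_order (partial_homeos ideals)\<^esub> representation b"
proof -
  define c where "c = a \<sqinter>\<^bsub>natural_order A\<^esub> b"
  have c: "c \<in> carrier A" "c \<preceq> a" "c \<preceq> b" using meet_props[OF a b] by (auto simp: c_def)
  note r = representation_phomeo[OF a] representation_phomeo[OF b] representation_phomeo[OF c(1)]
  have "representation a \<sqinter>\<^bsub>natural_order (partial_homeos ideals)\<^esub> representation b = representation c"
  proof (rule Y.PH.meet_eqI)
    show "representation c \<sqsubseteq>\<^bsub>natural_order (partial_homeos ideals)\<^esub> representation a"
      "representation c \<sqsubseteq>\<^bsub>natural_order (partial_homeos ideals)\<^esub> representation b"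
      using c a b representation_mono by auto
    fix F assume "F \<in> carrier (partial_homeos ideals)"
      and Fab: "F \<sqsubseteq>\<^bsub>natural_order (partial_homeos ideals)\<^esub> representation a"
        "F \<sqsubseteq>\<^bsub>natural_order (partial_homeos ideals)\<^esub> representation b"
    then have F: "F \<in> phomeos ideals" by simp
    have sub: "phomeo_graph ideals F \<subseteq> phomeo_graph ideals (representation a)"
      "phomeo_graph ideals F \<subseteq> phomeo_graph ideals (representation b)"
      using Fab F r Y.graph_subset_iff by auto
    have "(U, V) \<in> phomeo_graph ideals (representation c)" if UV: "(U, V) \<in> phomeo_graph ideals F" for U V
    proof -
      have U: "join_ideal U" "U \<subseteq> domain_of a" "V = translate a U"
        using UV sub(1) representation_graph[OF a] by blast+
      have x: "x \<in> domain_of c \<and> c \<odot> x = a \<odot> x" if xU: "x \<in> U" for x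
      proof -
        have xc: "x \<in> carrier A" and xa: "\<iota> a \<odot> (a \<odot> x) = x" using xU U by (auto simp: domain_of_def)
        \<comment> \<open>A lower bound \<open>F\<close> acts on every open inside its source, in
          particular on the principal ideal of \<open>x\<close>; there it agrees with both
          translations.\<close>
        have "below x \<in> carrier ideals" "below x \<sqsubseteq>\<^bsub>ideals\<^esub> U"
          using join_ideal_below[OF xc] join_idealD(2)[OF U(1) xU] by (auto simp: below_def)
        from Y.principal_iso_image_below[OF Y.principal_iso_graph[OF F] UV this]
        obtain W where W: "(below x, W) \<in> phomeo_graph ideals F" .
        have "translate a (below x) = translate b (below x)"
          using subsetD[OF sub(1) W] subsetD[OF sub(2) W] representation_graph[OF a] representation_graph[OF b]
          by simp
        then have ax: "a \<odot> x = b \<odot> x" using a b xc by (intro translate_below_eq)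
        \<comment> \<open>The restriction of \<open>a\<close> to the range idempotent of
          \<open>x\<close>. As \<open>a \<odot> x = b \<odot> x\<close>, it is also a restriction of
          \<open>b\<close>, hence lies below the meet \<open>c\<close>.\<close>
        define g where "g = a \<odot> (x \<odot> \<iota> x)"
        have gb: "g = b \<odot> (x \<odot> \<iota> x)"
          unfolding g_def using a b xc ax by (metis mul_assoc sinv_closed)
        have "g \<preceq> b" using b xc by (simp add: gb)
        moreover have "g \<preceq> a" "g \<in> carrier A" using a xc by (simp_all add: g_def)
        ultimately have "g \<preceq> c" unfolding c_def using pg_meet_greatest[OF a b] by simp
        then obtain f where f: "f \<in> idempotents A" "g = c \<odot> f" by (auto simp: nat_le_iff)
        have fc: "f \<in> carrier A" using f by auto
        have "a \<odot> x = g \<odot> x" using a xc by (simp add: g_def mul_assoc sinv_cancel)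
        \<comment> \<open>Here \<open>a \<odot> x\<close> is rewritten as
          \<open>c \<odot> f \<odot> x\<close>. Trading \<open>\<iota> a\<close> for
          \<open>\<iota> c\<close> in front of \<open>c\<close> then exhibits \<open>x\<close> as a
          value of left multiplication by \<open>\<iota> c \<odot> c\<close>, so \<open>x\<close> is
          fixed by it.\<close>
        then have "x = \<iota> a \<odot> (c \<odot> (f \<odot> x))" using xa f c fc xc by (simp add: mul_assoc)
        also have "\<dots> = \<iota> c \<odot> (c \<odot> (f \<odot> x))"
          using nat_le_eq(2)[OF c(1) a c(2)] a c fc xc by (metis mul_assoc mul_closed sinv_closed)
        finally have x': "\<iota> c \<odot> (c \<odot> (f \<odot> x)) = x" by simp
        have cx: "\<iota> c \<odot> (c \<odot> x) = x"
          using sinv_cancel(2)[OF c(1), of "c \<odot> (f \<odot> x)"] c(1) fc xc unfolding x' by simp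
        have "c \<odot> x = a \<odot> (\<iota> c \<odot> c) \<odot> x" using nat_le_eq(1)[OF c(1) a c(2)] by simp
        also have "\<dots> = a \<odot> x" using a c xc cx by (simp add: mul_assoc)
        finally show ?thesis using cx xc by (simp add: domain_of_def)
      qed
      then have "translate a U = translate c U" unfolding translate_def by (intro image_cong) auto
      then show ?thesis using x U representation_graph[OF c(1)] by auto
    qed
    then show "F \<sqsubseteq>\<^bsub>natural_order (partial_homeos ideals)\<^esub> representation c"
      using F r Y.graph_subset_iff by auto
  qed (use r in auto)
  then show ?thesis unfolding c_def by simp
qed

theorem representation_hom: "pseudogroup_hom A (partial_homeos ideals) representation"
proof -
  interpret B: pseudogroup "partial_homeos ideals" by (rule Y.pseudogroup_partial_homeos)
  show ?thesis
    by unfold_locales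
      (auto simp: representation_phomeo representation_mul representation_unit representation_join representation_meet)
qed

end

theorem theorem1p2:
  fixes A :: "'a semigroup_obj"
  assumes "pseudogroup A"
  shows "\<exists>(Y :: 'a set gorder) h. frame Y \<and>
    pseudogroup_hom A (partial_homeos Y) h \<and> inj_on h (carrier A)"
  using pseudogroup.frame_ideals[OF assms] pseudogroup.representation_hom[OF assms]
    pseudogroup.representation_inj[OF assms] by blast

end
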